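(* Let $p$ be a prime and let $H$ be a finite $p$-group such that every non-abelian subgroup of $H$ has an elementary abelian center. Then, for each finite abelian $p$-group $M$ acting on $H$, the number of crossed homomorphisms $M\to H$ is divisible by $\gcd(|H|,|M|)$.
   Context: All group actions are right actions; a group $M$ acts on a group $H$ by automorphisms, and the image of $h\in H$ under $a\in M$ is written $h^a$. A map $\alpha\colon M\to H$ is a crossed homomorphism if $\alpha(ab)=\alpha(a)^b\,\alpha(b)$ for all $a,b\in M$. *)

theory Defs
  imports "HOL-Algebra.Algebra" "HOL-Computational_Algebra.Primes"
begin

definition finite_p_group :: "nat \<Rightarrow> ('a, 'b) monoid_scheme \<Rightarrow> bool"
  where "finite_p_group p G \<longleftrightarrow>
    Factorial_Ring.prime p \<and> group G \<and> finite (carrier G) \<and> (\<exists>n. order G = p ^ n)"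

(* The trivial group counts as elementary abelian. *)
definition elementary_abelian :: "nat \<Rightarrow> ('a, 'b) monoid_scheme \<Rightarrow> bool"
  where "elementary_abelian p G \<longleftrightarrow>
    Factorial_Ring.prime p \<and> comm_group G \<and> (\<forall>x\<in>carrier G. x [^]\<^bsub>G\<^esub> p = \<one>\<^bsub>G\<^esub>)"

definition group_center :: "('a, 'b) monoid_scheme \<Rightarrow> 'a set"
  where "group_center G =
    {z \<in> carrier G. \<forall>x\<in>carrier G. z \<otimes>\<^bsub>G\<^esub> x = x \<otimes>\<^bsub>G\<^esub> z}"

(* Right action of M on H by automorphisms; act h a is h^a.  Since iso constrains maps only
   on the carrier, act is unrestricted outside of carrier H and carrier M. *)
locale right_group_action = M: group M + H: group H
  for M :: "('m, 'x) monoid_scheme" and H :: "('h, 'y) monoid_scheme"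
    and act :: "'h \<Rightarrow> 'm \<Rightarrow> 'h" +
  assumes act_automorphism: "a \<in> carrier M \<Longrightarrow> (\<lambda>h. act h a) \<in> iso H H"
    and act_one: "h \<in> carrier H \<Longrightarrow> act h \<one>\<^bsub>M\<^esub> = h"
    and act_mult: "\<lbrakk>h \<in> carrier H; a \<in> carrier M; b \<in> carrier M\<rbrakk>
      \<Longrightarrow> act h (a \<otimes>\<^bsub>M\<^esub> b) = act (act h a) b"

(* Maps are taken extensional on carrier M, so that each crossed homomorphism is counted
   exactly once. *)
definition crossed_homs ::
    "('m, 'x) monoid_scheme \<Rightarrow> ('h, 'y) monoid_scheme \<Rightarrow> ('h \<Rightarrow> 'm \<Rightarrow> 'h) \<Rightarrow> ('m \<Rightarrow> 'h) set"
  where "crossed_homs M H act =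
    {\<alpha> \<in> carrier M \<rightarrow>\<^sub>E carrier H.
      \<forall>a\<in>carrier M. \<forall>b\<in>carrier M. \<alpha> (a \<otimes>\<^bsub>M\<^esub> b) = act (\<alpha> a) b \<otimes>\<^bsub>H\<^esub> \<alpha> b}"

end

theory Submission
  imports Defs
begin

text \<open>
  Choose a basis of \<open>M\<close>.  In the semidirect product of \<open>M\<close> and \<open>H\<close>, crossed homomorphisms become
  commuting tuples \<open>(g\<^sub>i)\<close> with \<open>g\<^sub>i\<close> in a prescribed coset \<open>H c\<^sub>i\<close> and \<open>g\<^sub>i\<close> to the power \<open>p^n\<^sub>i\<close> equal to
  a prescribed \<open>t\<^sub>i\<close> centralizing \<open>H\<close> (initially \<open>t\<^sub>i = 1\<close>).  In this form the count is shown to be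
  divisible by \<open>gcd (p^(\<Sum>n\<^sub>i)) |H|\<close> by induction on \<open>\<Sum>n\<^sub>i\<close>.

  Fix \<open>i\<close> with \<open>n\<^sub>i = m + 1\<close> and let \<open>Y\<close> be the set of tuples without the \<open>i\<close>-th power condition;
  \<open>|H|\<close> divides \<open>|Y|\<close> because the possible \<open>g\<^sub>i\<close> form a coset of the stabilizer in \<open>H\<close> of the remaining
  coordinates.  Split \<open>Y\<close> by the value \<open>x\<close> of \<open>g\<^sub>i\<close> to the power \<open>p^m\<close>.  If \<open>x\<close> does not centralize \<open>H\<close>,
  the induction hypothesis applies to \<open>C\<^sub>H(x)\<close> in place of \<open>H\<close>, and the class of \<open>x\<close>, of size
  \<open>|H : C\<^sub>H(x)| \<ge> p\<close>, supplies the missing factor.  Two values centralizing \<open>H\<close> differ by an element of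
  \<open>Z(H)\<close>.  If \<open>H\<close> is not abelian, this element has exponent \<open>p\<close>, so either all or none of these values
  satisfy \<open>x^p = t\<^sub>i\<close>, and their total contribution is controlled by \<open>|Y|\<close>.  If \<open>H\<close> is abelian, either
  there is at most one such value, or translating by a quotient of two tuples permutes the values
  freely with orbits of length \<open>p\<close>.
\<close>

section \<open>Conjugation and weighted orbit sums\<close>

lemma (in group) inv_mult_cancel [simp]:
  "\<lbrakk>x \<in> carrier G; y \<in> carrier G\<rbrakk> \<Longrightarrow> inv x \<otimes> (x \<otimes> y) = y"
  "\<lbrakk>x \<in> carrier G; y \<in> carrier G\<rbrakk> \<Longrightarrow> x \<otimes> (inv x \<otimes> y) = y"
  by (simp_all flip: m_assoc)

lemma (in group) mult_inv_eq_iff: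
  assumes "x \<in> carrier G" "y \<in> carrier G" "z \<in> carrier G"
  shows "x \<otimes> inv y = z \<longleftrightarrow> x = z \<otimes> y"
proof
  show "x \<otimes> inv y = z \<Longrightarrow> x = z \<otimes> y"
    using assms by (auto simp: m_assoc)
  show "x = z \<otimes> y \<Longrightarrow> x \<otimes> inv y = z"
    using assms by (simp add: m_assoc)
qed

text \<open>Conjugation from the left, so that it composes as a left action and can serve as
  \<open>\<phi>\<close> in \<open>orbit_weighted_sum_dvd\<close>.\<close>

definition conjugate :: "('g, 'x) monoid_scheme \<Rightarrow> 'g \<Rightarrow> 'g \<Rightarrow> 'g"
  where "conjugate G h x = h \<otimes>\<^bsub>G\<^esub> x \<otimes>\<^bsub>G\<^esub> inv\<^bsub>G\<^esub> h"

context group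
begin

lemma conjugate_closed [simp]:
  "\<lbrakk>h \<in> carrier G; x \<in> carrier G\<rbrakk> \<Longrightarrow> conjugate G h x \<in> carrier G"
  by (simp add: conjugate_def)

lemma conjugate_one [simp]: "x \<in> carrier G \<Longrightarrow> conjugate G \<one> x = x"
  by (simp add: conjugate_def)

lemma conjugate_mult:
  "\<lbrakk>h \<in> carrier G; x \<in> carrier G; y \<in> carrier G\<rbrakk>
    \<Longrightarrow> conjugate G h (x \<otimes> y) = conjugate G h x \<otimes> conjugate G h y"
  by (simp add: conjugate_def m_assoc)

lemma conjugate_conjugate:
  "\<lbrakk>h \<in> carrier G; k \<in> carrier G; x \<in> carrier G\<rbrakk>
    \<Longrightarrow> conjugate G h (conjugate G k x) = conjugate G (h \<otimes> k) x"
  by (simp add: conjugate_def m_assoc inv_mult_group)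

lemma conjugate_pow:
  "\<lbrakk>h \<in> carrier G; x \<in> carrier G\<rbrakk>
    \<Longrightarrow> conjugate G h (x [^] (n::nat)) = conjugate G h x [^] n"
  by (induction n) (simp_all add: conjugate_mult, simp add: conjugate_def)

lemma conjugate_eq_iff:
  "\<lbrakk>h \<in> carrier G; x \<in> carrier G\<rbrakk> \<Longrightarrow> conjugate G h x = x \<longleftrightarrow> h \<otimes> x = x \<otimes> h"
  by (simp add: conjugate_def mult_inv_eq_iff)

text \<open>Conjugation by \<open>x\<close> is multiplicative and fixes \<open>y\<close>, hence
  fixes every power of \<open>y\<close>.\<close>

lemma commute_pow:
  assumes "x \<in> carrier G" "y \<in> carrier G" "x \<otimes> y = y \<otimes> x"
  shows "x \<otimes> y [^] (n::nat) = y [^] n \<otimes> x"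
  using assms by (metis conjugate_eq_iff conjugate_pow nat_pow_closed)

text \<open>The weight is constant on orbits, so the orbit of \<open>x\<close> contributes
  \<open>w x\<close> times the index of the stabilizer. The last hypothesis says that
  \<open>d\<close> divides this contribution, cleared of the division by the order of the
  stabilizer. It is applied below to conjugation of values, to conjugation of tuples and to
  translation by a group of order \<open>p\<close>.\<close>

lemma orbit_weighted_sum_dvd:
  fixes \<phi> :: "'a \<Rightarrow> 'x \<Rightarrow> 'x" and w :: "'x \<Rightarrow> nat"
  assumes H: "subgroup H G" "finite H" and "finite S"
    and closed: "\<And>h x. \<lbrakk>h \<in> H; x \<in> S\<rbrakk> \<Longrightarrow> \<phi> h x \<in> S"
    and one: "\<And>x. x \<in> S \<Longrightarrow> \<phi> \<one> x = x"
    and comp: "\<And>h k x. \<lbrakk>h \<in> H; k \<in> H; x \<in> S\<rbrakk> \<Longrightarrow> \<phi> h (\<phi> k x) = \<phi> (h \<otimes> k) x"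
    and inv: "\<And>h x. \<lbrakk>h \<in> H; x \<in> S\<rbrakk> \<Longrightarrow> w (\<phi> h x) = w x"
    and dvd: "\<And>x. x \<in> S \<Longrightarrow> d * card {h \<in> H. \<phi> h x = x} dvd w x * card H"
  shows "d dvd sum w S"
proof -
  interpret H: subgroup H G by fact
  define Orb where "Orb x = (\<lambda>h. \<phi> h x) ` H" for x
  have Orb_sub: "Orb x \<subseteq> S" if "x \<in> S" for x
    using that closed by (auto simp: Orb_def)
  have in_Orb: "x \<in> Orb x" if "x \<in> S" for x
    unfolding Orb_def using one[OF that] by (intro image_eqI[where x = "\<one>"]) auto
  have Orb_eq: "Orb y = Orb x" if x: "x \<in> S" and y: "y \<in> Orb x" for x y
  proof -
    obtain k where k: "k \<in> H" "y = \<phi> k x" using y by (auto simp: Orb_def)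
    have "\<phi> h y \<in> Orb x" if "h \<in> H" for h
      using that k x comp by (auto simp: Orb_def)
    moreover have "\<phi> h x \<in> Orb y" if h: "h \<in> H" for h
    proof -
      have "\<phi> (h \<otimes> inv k) y = \<phi> (h \<otimes> inv k \<otimes> k) x"
        using h k x comp by simp
      also have "\<dots> = \<phi> h x" using h k by (simp add: m_assoc)
      finally show ?thesis using h k by (metis H.m_closed H.m_inv_closed Orb_def image_eqI)
    qed
    ultimately show ?thesis by (auto simp: Orb_def)
  qed
  \<comment> \<open>Orbit-stabilizer: the fibres of \<open>\<lambda>h. \<phi> h x\<close> over the
    orbit are left translates of the stabilizer, so all have its size.\<close>
  have card_Orb: "card H = card (Orb x) * card {h \<in> H. \<phi> h x = x}" if x: "x \<in> S" for x
  proof -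
    have "card {h \<in> H. \<phi> h x = y} = card {h \<in> H. \<phi> h x = x}" if y: "y \<in> Orb x" for y
    proof -
      obtain k where k: "k \<in> H" "y = \<phi> k x" using y by (auto simp: Orb_def)
      have "bij_betw (\<lambda>h. k \<otimes> h) {h \<in> H. \<phi> h x = x} {h \<in> H. \<phi> h x = y}"
      proof (rule bij_betwI[where g = "\<lambda>h. inv k \<otimes> h"])
        show "(\<lambda>h. k \<otimes> h) \<in> {h \<in> H. \<phi> h x = x} \<rightarrow> {h \<in> H. \<phi> h x = y}"
        proof (intro Pi_I, clarify)
          fix h assume h: "h \<in> H" "\<phi> h x = x"
          have "\<phi> (k \<otimes> h) x = y" using comp[OF k(1) h(1) x] h(2) k(2) by simp
          then show "k \<otimes> h \<in> H \<and> \<phi> (k \<otimes> h) x = y" using h(1) k(1) by blast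
        qed
        have "\<phi> (inv k \<otimes> h) x = x" if "h \<in> H" "\<phi> h x = y" for h
        proof -
          have "\<phi> (inv k \<otimes> h) x = \<phi> (inv k \<otimes> k) x"
            using comp[OF _ that(1) x, of "inv k"] comp[OF _ k(1) x, of "inv k"] that(2) k
            by (metis H.m_inv_closed)
          then show ?thesis using k(1) one[OF x] by simp
        qed
        then show "(\<lambda>h. inv k \<otimes> h) \<in> {h \<in> H. \<phi> h x = y} \<rightarrow> {h \<in> H. \<phi> h x = x}"
          using k by auto
      qed (use k in auto)
      then show ?thesis by (simp add: bij_betw_same_card)
    qed
    moreover have "card H = (\<Sum>y\<in>Orb x. card {h \<in> H. \<phi> h x = y})"
      using sum.image_gen[OF H(2), of "\<lambda>_. 1::nat" "\<lambda>h. \<phi> h x"] by (simp add: Orb_def)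
    ultimately show ?thesis by simp
  qed
  have Union_Orb: "\<Union>(Orb ` S) = S" using Orb_sub in_Orb by blast
  have "sum w (\<Union>(Orb ` S)) = (\<Sum>Q\<in>Orb ` S. sum w Q)"
  proof (rule sum.Union_disjoint[unfolded comp_def])
    show "\<forall>A\<in>Orb ` S. finite A" using H(2) by (auto simp: Orb_def)
    show "\<forall>A\<in>Orb ` S. \<forall>B\<in>Orb ` S. A \<noteq> B \<longrightarrow> A \<inter> B = {}"
      using Orb_eq by blast
  qed
  then have sum_S: "sum w S = (\<Sum>Q\<in>Orb ` S. sum w Q)" by (simp only: Union_Orb)
  have dvd_Orb: "d dvd sum w (Orb x)" if x: "x \<in> S" for x
  proof -
    have "sum w (Orb x) = card (Orb x) * w x"
    proof -
      have "sum w (Orb x) = (\<Sum>y\<in>Orb x. w x)"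
        using x inv by (intro sum.cong) (auto simp: Orb_def)
      then show ?thesis by simp
    qed
    \<comment> \<open>The order of the stabilizer, positive because of \<open>\<one>\<close>,
      cancels from both sides.\<close>
    moreover have "d * card {h \<in> H. \<phi> h x = x} dvd w x * (card (Orb x) * card {h \<in> H. \<phi> h x = x})"
      using dvd[OF x] card_Orb[OF x] by simp
    moreover have "card {h \<in> H. \<phi> h x = x} > 0"
      using one[OF x] H(2) by (auto simp: card_gt_0_iff intro: exI[of _ \<one>])
    ultimately show ?thesis by (simp add: mult_ac)
  qed
  show ?thesis
    unfolding sum_S by (rule dvd_sum) (elim imageE, simp add: dvd_Orb)
qed

end

section \<open>Commuting tuples in prescribed cosets\<close>

text \<open>One inclusion suffices as a definition: for a finite subgroup, injectivity of
  conjugation turns it into equality.\<close>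

definition normalizes :: "('g, 'x) monoid_scheme \<Rightarrow> 'g set \<Rightarrow> 'g \<Rightarrow> bool"
  where "normalizes G H c \<longleftrightarrow> c \<in> carrier G \<and> (\<forall>h\<in>H. conjugate G c h \<in> H)"

definition commuting_tuples ::
    "('g, 'x) monoid_scheme \<Rightarrow> 'g set \<Rightarrow> 'i set \<Rightarrow> ('i \<Rightarrow> 'g) \<Rightarrow> 'i set \<Rightarrow> ('i \<Rightarrow> nat) \<Rightarrow> ('i \<Rightarrow> 'g)
      \<Rightarrow> ('i \<Rightarrow> 'g) set"
  where "commuting_tuples G H I c J e t =
    {g \<in> I \<rightarrow>\<^sub>E carrier G. (\<forall>i\<in>I. g i \<otimes>\<^bsub>G\<^esub> inv\<^bsub>G\<^esub> c i \<in> H) \<and>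
      (\<forall>i\<in>I. \<forall>j\<in>I. g i \<otimes>\<^bsub>G\<^esub> g j = g j \<otimes>\<^bsub>G\<^esub> g i) \<and> (\<forall>j\<in>J. g j [^]\<^bsub>G\<^esub> e j = t j)}"

context group
begin

lemma commuting_tuplesD:
  assumes "g \<in> commuting_tuples G H I c J e t"
  shows "g \<in> I \<rightarrow>\<^sub>E carrier G" "\<And>i. i \<in> I \<Longrightarrow> g i \<in> carrier G"
    "\<And>i. i \<in> I \<Longrightarrow> g i \<otimes> inv c i \<in> H"
    "\<And>i j. \<lbrakk>i \<in> I; j \<in> I\<rbrakk> \<Longrightarrow> g i \<otimes> g j = g j \<otimes> g i"
    "\<And>j. j \<in> J \<Longrightarrow> g j [^] e j = t j"
  using assms by (auto simp: commuting_tuples_def)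

lemma commuting_tuplesI:
  assumes "g \<in> extensional I" "\<And>i. i \<in> I \<Longrightarrow> g i \<in> carrier G"
    "\<And>i. i \<in> I \<Longrightarrow> g i \<otimes> inv c i \<in> H"
    "\<And>i j. \<lbrakk>i \<in> I; j \<in> I\<rbrakk> \<Longrightarrow> g i \<otimes> g j = g j \<otimes> g i"
    "\<And>j. j \<in> J \<Longrightarrow> g j [^] e j = t j"
  shows "g \<in> commuting_tuples G H I c J e t"
  using assms by (auto simp: commuting_tuples_def PiE_def)

lemma commuting_tuples_cong:
  assumes "\<And>j. j \<in> J \<Longrightarrow> e j = e' j" "\<And>j. j \<in> J \<Longrightarrow> t j = t' j"
  shows "commuting_tuples G H I c J e t = commuting_tuples G H I c J e' t'"
  using assms by (simp add: commuting_tuples_def)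

lemma finite_commuting_tuples:
  assumes "finite I" "finite H" "\<And>i. i \<in> I \<Longrightarrow> c i \<in> carrier G"
  shows "finite (commuting_tuples G H I c J e t)"
proof (rule finite_subset)
  show "commuting_tuples G H I c J e t \<subseteq> (\<Pi>\<^sub>E i\<in>I. (\<lambda>h. h \<otimes> c i) ` H)"
  proof
    fix g assume g: "g \<in> commuting_tuples G H I c J e t"
    have "g i \<in> (\<lambda>h. h \<otimes> c i) ` H" if "i \<in> I" for i
      using commuting_tuplesD(2,3)[OF g that] assms(3)[OF that]
      by (intro image_eqI[where x = "g i \<otimes> inv c i"]) (auto simp: m_assoc)
    then show "g \<in> (\<Pi>\<^sub>E i\<in>I. (\<lambda>h. h \<otimes> c i) ` H)"
      using commuting_tuplesD(1)[OF g] by auto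
  qed
  show "finite (\<Pi>\<^sub>E i\<in>I. (\<lambda>h. h \<otimes> c i) ` H)"
    using assms(1,2) by (intro finite_PiE) auto
qed

section \<open>Cosets of a normalized subgroup under powers, quotients and conjugation\<close>

lemma normalizes_pow:
  assumes "normalizes G H c" "H \<subseteq> carrier G"
  shows "normalizes G H (c [^] (m::nat))"
proof (induction m)
  case 0
  then show ?case using assms by (auto simp: normalizes_def)
next
  case (Suc m)
  have "conjugate G (c [^] Suc m) h = conjugate G (c [^] m) (conjugate G c h)" if "h \<in> H" for h
    using that assms by (subst conjugate_conjugate) (auto simp: normalizes_def)
  then show ?case using Suc assms by (auto simp: normalizes_def)
qed

text \<open>Since \<open>c\<close> normalizes \<open>H\<close>, cosets multiply: the
  \<open>m\<close>-th powers of elements of \<open>H c\<close> all lie in the coset of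
  \<open>c [^] m\<close>.\<close>

lemma coset_pow:
  assumes H: "subgroup H G" and c: "normalizes G H c"
    and g: "g \<in> carrier G" "g \<otimes> inv c \<in> H"
  shows "g [^] (m::nat) \<otimes> inv (c [^] m) \<in> H"
proof (induction m)
  case 0
  then show ?case using subgroup.one_closed[OF H] by simp
next
  case (Suc m)
  interpret H: subgroup H G by fact
  have cc: "c \<in> carrier G" using c by (simp add: normalizes_def)
  \<comment> \<open>Insert the inverse of \<open>c [^] m\<close> times \<open>c [^] m\<close> before
    the last factor \<open>g\<close>; the second factor is then a conjugate of an element of
    \<open>H\<close>.\<close>
  have "g [^] Suc m \<otimes> inv (c [^] Suc m)
    = (g [^] m \<otimes> inv (c [^] m)) \<otimes> conjugate G (c [^] m) (g \<otimes> inv c)"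
    using g cc by (simp add: conjugate_def m_assoc inv_mult_group)
  also have "\<dots> \<in> H"
    using Suc normalizes_pow[OF c, of m] g H.subset by (auto simp: normalizes_def)
  finally show ?case .
qed

lemma coset_quotient:
  assumes "subgroup H G" "c \<in> carrier G" "g \<in> carrier G" "g' \<in> carrier G"
    "g \<otimes> inv c \<in> H" "g' \<otimes> inv c \<in> H"
  shows "g \<otimes> inv g' \<in> H"
proof -
  have "g \<otimes> inv g' = (g \<otimes> inv c) \<otimes> inv (g' \<otimes> inv c)"
    using assms by (simp add: inv_mult_group m_assoc)
  then show ?thesis using assms by (simp add: subgroup.m_closed subgroup.m_inv_closed)
qed

text \<open>Write \<open>g\<close> as \<open>g \<otimes> inv c\<close> times \<open>c\<close>; both
  factors normalize \<open>H\<close>.\<close>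

lemma normalizes_coset:
  assumes H: "subgroup H G" and c: "normalizes G H c" and g: "g \<in> carrier G" "g \<otimes> inv c \<in> H"
  shows "normalizes G H g"
proof -
  interpret H: subgroup H G by fact
  have "conjugate G g h = conjugate G (g \<otimes> inv c) (conjugate G c h)" if "h \<in> H" for h
    using that g c by (subst conjugate_conjugate) (auto simp: normalizes_def m_assoc)
  moreover have "conjugate G h k \<in> H" if "h \<in> H" "k \<in> H" for h k
    using that by (simp add: conjugate_def)
  ultimately show ?thesis using g c by (simp add: normalizes_def)
qed

text \<open>Moving \<open>inv h\<close> past \<open>g\<close> turns it into a conjugate that stays
  in \<open>H\<close>, because \<open>g\<close> normalizes \<open>H\<close> as well.\<close>

lemma conjugate_coset:
  assumes H: "subgroup H G" and c: "normalizes G H c"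
    and g: "g \<in> carrier G" "g \<otimes> inv c \<in> H" and h: "h \<in> H"
  shows "conjugate G h g \<otimes> inv c \<in> H"
proof -
  interpret H: subgroup H G by fact
  have n: "normalizes G H g" by (rule normalizes_coset[OF H c g])
  have "conjugate G h g \<otimes> inv c = h \<otimes> conjugate G g (inv h) \<otimes> (g \<otimes> inv c)"
    using h g c by (simp add: conjugate_def normalizes_def m_assoc)
  then show ?thesis using n h g by (simp add: normalizes_def)
qed

lemma conjugate_commuting_tuples:
  assumes H: "subgroup H G" and c: "\<And>i. i \<in> I \<Longrightarrow> normalizes G H (c i)" and h: "h \<in> H" and J: "J \<subseteq> I"
    and g: "g \<in> commuting_tuples G H I c J e t"
  shows "(\<lambda>i\<in>I. conjugate G h (g i)) \<in> commuting_tuples G H I c J e (\<lambda>j. conjugate G h (t j))"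
proof (rule commuting_tuplesI)
  interpret H: subgroup H G by fact
  note D = commuting_tuplesD[OF g]
  show "(\<lambda>i\<in>I. conjugate G h (g i)) \<in> extensional I" by simp
  show "(\<lambda>i\<in>I. conjugate G h (g i)) i \<in> carrier G" if "i \<in> I" for i
    using that D(2) h by simp
  show "(\<lambda>i\<in>I. conjugate G h (g i)) i \<otimes> inv c i \<in> H" if "i \<in> I" for i
    using conjugate_coset[OF H c D(2) D(3) h] that by simp
  show "(\<lambda>i\<in>I. conjugate G h (g i)) i \<otimes> (\<lambda>i\<in>I. conjugate G h (g i)) j =
    (\<lambda>i\<in>I. conjugate G h (g i)) j \<otimes> (\<lambda>i\<in>I. conjugate G h (g i)) i" if "i \<in> I" "j \<in> I" for i j
    using D(4)[OF that] that D(2) h by (simp flip: conjugate_mult)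
  show "(\<lambda>i\<in>I. conjugate G h (g i)) j [^] e j = conjugate G h (t j)" if "j \<in> J" for j
    using that J D(2) D(5)[OF that] h by (auto simp flip: conjugate_pow)
qed

text \<open>Conjugation by \<open>h\<close> and by its inverse give injections in both directions
  between finite sets.\<close>

lemma card_conjugate_commuting_tuples:
  assumes I: "finite I" and H: "subgroup H G" "finite H" and c: "\<And>i. i \<in> I \<Longrightarrow> normalizes G H (c i)"
    and h: "h \<in> H" and J: "J \<subseteq> I" and t: "\<And>j. j \<in> J \<Longrightarrow> t j \<in> carrier G"
  shows "card (commuting_tuples G H I c J e (\<lambda>j. conjugate G h (t j))) = card (commuting_tuples G H I c J e t)"
proof -
  interpret H: subgroup H G by fact
  \<comment> \<open>Stated for every \<open>h\<close> and \<open>t\<close>, so that it can be used a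
    second time with \<open>inv h\<close> and the conjugated targets.\<close>
  have le: "card (commuting_tuples G H I c J e t) \<le> card (commuting_tuples G H I c J e (\<lambda>j. conjugate G h (t j)))"
    if h: "h \<in> H" for h t
  proof (rule card_inj_on_le)
    show "(\<lambda>g. \<lambda>i\<in>I. conjugate G h (g i)) ` commuting_tuples G H I c J e t
        \<subseteq> commuting_tuples G H I c J e (\<lambda>j. conjugate G h (t j))"
      using conjugate_commuting_tuples[where c = c, OF H(1) c h J] by blast
    show "finite (commuting_tuples G H I c J e (\<lambda>j. conjugate G h (t j)))"
      using I H(2) c by (intro finite_commuting_tuples) (auto simp: normalizes_def)
    show "inj_on (\<lambda>g. \<lambda>i\<in>I. conjugate G h (g i)) (commuting_tuples G H I c J e t)"
    proof (rule inj_onI)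
      fix g g' assume g: "g \<in> commuting_tuples G H I c J e t" "g' \<in> commuting_tuples G H I c J e t"
        and eq: "(\<lambda>i\<in>I. conjugate G h (g i)) = (\<lambda>i\<in>I. conjugate G h (g' i))"
      show "g = g'"
      proof (rule PiE_ext[OF commuting_tuplesD(1)[OF g(1)] commuting_tuplesD(1)[OF g(2)]])
        fix i assume i: "i \<in> I"
        then have "conjugate G h (g i) = conjugate G h (g' i)" using fun_cong[OF eq, of i] by simp
        then show "g i = g' i"
          using commuting_tuplesD(2)[OF g(1) i] commuting_tuplesD(2)[OF g(2) i] h
          by (simp add: conjugate_def)
      qed
    qed
  qed
  have "commuting_tuples G H I c J e (\<lambda>j. conjugate G (inv h) (conjugate G h (t j))) = commuting_tuples G H I c J e t"
    using t h by (intro commuting_tuples_cong) (simp_all add: conjugate_conjugate)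
  then show ?thesis
    using le[OF h, of t] le[of "inv h" "\<lambda>j. conjugate G h (t j)"] h by simp
qed

text \<open>Let \<open>b\<close> be the coordinates other than \<open>i\<close>. The admissible
  values of the free coordinate are either absent or form a coset of the centralizer of
  \<open>b\<close> in \<open>H\<close>, which is the stabilizer of \<open>b\<close> under
  coordinatewise conjugation. A whole orbit of such \<open>b\<close> therefore contributes 0 or
  index times order of the stabilizer, that is \<open>card H\<close>.\<close>

lemma card_dvd_card_commuting_tuples:
  assumes I: "finite I" and H: "subgroup H G" "finite H" and c: "\<And>i. i \<in> I \<Longrightarrow> normalizes G H (c i)"
    and i: "i \<in> I"
    and t: "\<And>j h. \<lbrakk>j \<in> I; h \<in> H\<rbrakk> \<Longrightarrow> conjugate G h (t j) = t j"
  shows "card H dvd card (commuting_tuples G H I c (I - {i}) e t)"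
proof -
  interpret H: subgroup H G by fact
  define J where "J = I - {i}"
  define B where "B = commuting_tuples G H J c J e t"
  define A where "A b = {y \<in> carrier G. y \<otimes> inv c i \<in> H \<and> (\<forall>j\<in>J. y \<otimes> b j = b j \<otimes> y)}" for b
  define \<phi> where "\<phi> h b = (\<lambda>j\<in>J. conjugate G h (b j))" for h b
  have I_eq: "I = insert i J" and iJ: "i \<notin> J" using i by (auto simp: J_def)
  have cc: "c j \<in> carrier G" if "j \<in> I" for j using c[OF that] by (simp add: normalizes_def)
  have finB: "finite B"
    unfolding B_def using I H(2) cc by (intro finite_commuting_tuples) (auto simp: J_def)
  have A_fin: "finite (A b)" for b
  proof (rule finite_subset)
    show "A b \<subseteq> (\<lambda>h. h \<otimes> c i) ` H"
      using cc[OF i] by (auto simp: A_def m_assoc intro!: image_eqI[where x = "y \<otimes> inv c i" for y])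
  qed (use H(2) in auto)
  have BD: "\<And>j. j \<in> J \<Longrightarrow> b j \<in> carrier G" "b \<in> extensional J" if "b \<in> B" for b
    using commuting_tuplesD(1)[OF that[unfolded B_def]] by (auto simp: PiE_def)
  have \<phi>B: "\<phi> h b \<in> B" if "h \<in> H" "b \<in> B" for h b
  proof -
    have "\<phi> h b \<in> commuting_tuples G H J c J e (\<lambda>j. conjugate G h (t j))"
      unfolding \<phi>_def using that c H(1) by (intro conjugate_commuting_tuples) (auto simp: B_def J_def)
    also have "\<dots> = B"
      unfolding B_def using t that(1) by (intro commuting_tuples_cong) (auto simp: J_def)
    finally show ?thesis .
  qed
  \<comment> \<open>Separating the free coordinate turns the count into the sum of
    \<open>card (A b)\<close> over \<open>b\<close>, to which the orbit lemma applies.\<close>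
  have "bij_betw (\<lambda>g. (restrict g J, g i)) (commuting_tuples G H I c J e t) (Sigma B A)"
  proof (rule bij_betwI[where g = "\<lambda>(b, y). b(i := y)"])
    show "(\<lambda>g. (restrict g J, g i)) \<in> commuting_tuples G H I c J e t \<rightarrow> Sigma B A"
    proof
      fix g assume "g \<in> commuting_tuples G H I c J e t"
      note D = commuting_tuplesD[OF this]
      have "restrict g J \<in> B" unfolding B_def
        by (rule commuting_tuplesI) (use D I_eq in auto)
      moreover have "g i \<in> A (restrict g J)"
        using D i I_eq by (auto simp: A_def)
      ultimately show "(restrict g J, g i) \<in> Sigma B A" by simp
    qed
    show "(\<lambda>(b, y). b(i := y)) \<in> Sigma B A \<rightarrow> commuting_tuples G H I c J e t"
    proof (clarify)
      fix b y assume b: "b \<in> B" and y: "y \<in> A b"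
      note D = commuting_tuplesD[OF b[unfolded B_def]]
      show "b(i := y) \<in> commuting_tuples G H I c J e t"
      proof (rule commuting_tuplesI)
        show "b(i := y) \<in> extensional I" using BD(2)[OF b] I_eq by (auto simp: extensional_def)
      qed (use D y iJ in \<open>auto simp: A_def I_eq\<close>)
    qed
    show "(case (restrict g J, g i) of (b, y) \<Rightarrow> b(i := y)) = g"
      if g: "g \<in> commuting_tuples G H I c J e t" for g
      using commuting_tuplesD(1)[OF g] I_eq by (auto simp: fun_eq_iff PiE_def extensional_def)
    show "(restrict ((\<lambda>(b, y). b(i := y)) by) J, ((\<lambda>(b, y). b(i := y)) by) i) = by"
      if "by \<in> Sigma B A" for "by"
      using that iJ by (auto simp: fun_eq_iff extensional_arb[OF BD(2)])
  qed
  then have "card (commuting_tuples G H I c J e t) = card (Sigma B A)"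
    by (rule bij_betw_same_card)
  also have "\<dots> = (\<Sum>b\<in>B. card (A b))"
    using finB A_fin by (simp add: card_SigmaI)
  also have "card H dvd \<dots>"
  proof (rule orbit_weighted_sum_dvd[OF H finB, where \<phi> = \<phi>])
    show "\<phi> h b \<in> B" if "h \<in> H" "b \<in> B" for h b by (rule \<phi>B[OF that])
    show "\<phi> \<one> b = b" if "b \<in> B" for b
      using BD[OF that] by (auto simp: \<phi>_def fun_eq_iff extensional_def)
    show "\<phi> h (\<phi> k b) = \<phi> (h \<otimes> k) b" if "h \<in> H" "k \<in> H" "b \<in> B" for h k b
      using that BD(1)[OF that(3)] by (auto simp: \<phi>_def fun_eq_iff conjugate_conjugate)
    \<comment> \<open>Conjugation by \<open>h\<close> carries the admissible values for
      \<open>b\<close> to those for \<open>\<phi> h b\<close>; using the inverse of \<open>h\<close>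
      afterwards gives equality.\<close>
    have le: "card (A b) \<le> card (A (\<phi> h b))" if h: "h \<in> H" and b: "b \<in> B" for h b
    proof (rule card_inj_on_le[where f = "conjugate G h"])
      show "inj_on (conjugate G h) (A b)"
        using h by (auto simp: inj_on_def A_def conjugate_def)
      show "conjugate G h ` A b \<subseteq> A (\<phi> h b)"
      proof
        fix z assume "z \<in> conjugate G h ` A b"
        then obtain y where y: "y \<in> A b" "z = conjugate G h y" by blast
        then have "z \<in> carrier G" using h by (auto simp: A_def)
        moreover have "z \<otimes> inv c i \<in> H"
          using y conjugate_coset[OF H(1) c[OF i] _ _ h] by (auto simp: A_def)
        moreover have "z \<otimes> \<phi> h b j = \<phi> h b j \<otimes> z" if "j \<in> J" for j
          using y that BD(1)[OF b that] h by (auto simp: A_def \<phi>_def simp flip: conjugate_mult)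
        ultimately show "z \<in> A (\<phi> h b)" by (simp add: A_def)
      qed
    qed (rule A_fin)
    show "card (A (\<phi> h b)) = card (A b)" if h: "h \<in> H" and b: "b \<in> B" for h b
    proof -
      have "\<phi> (inv h) (\<phi> h b) = b"
        using h b BD[OF b] by (auto simp: \<phi>_def fun_eq_iff conjugate_conjugate extensional_def)
      then show ?thesis using le[OF h b] le[OF _ \<phi>B[OF h b], of "inv h"] h by simp
    qed
    \<comment> \<open>If \<open>A b\<close> is empty the weight is 0. Otherwise any \<open>y\<close>
      in \<open>A b\<close> is a base point that identifies the stabilizer with
      \<open>A b\<close>.\<close>
    show "card H * card {h \<in> H. \<phi> h b = b} dvd card (A b) * card H" if b: "b \<in> B" for b
    proof (cases "A b = {}")
      case False
      then obtain y where y: "y \<in> A b" by blast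
      have stab: "\<phi> h b = b \<longleftrightarrow> (\<forall>j\<in>J. h \<otimes> b j = b j \<otimes> h)" if h: "h \<in> H" for h
      proof -
        have "\<phi> h b = b \<longleftrightarrow> (\<forall>j\<in>J. conjugate G h (b j) = b j)"
          using BD(2)[OF b] by (auto simp: \<phi>_def fun_eq_iff extensional_def)
        then show ?thesis using h BD(1)[OF b] by (simp add: conjugate_eq_iff)
      qed
      have "bij_betw (\<lambda>h. h \<otimes> y) {h \<in> H. \<phi> h b = b} (A b)"
      proof (rule bij_betwI[where g = "\<lambda>z. z \<otimes> inv y"])
        show "(\<lambda>h. h \<otimes> y) \<in> {h \<in> H. \<phi> h b = b} \<rightarrow> A b"
        proof
          fix h assume "h \<in> {h \<in> H. \<phi> h b = b}"
          then have h: "h \<in> H" "\<And>j. j \<in> J \<Longrightarrow> h \<otimes> b j = b j \<otimes> h" using stab by auto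
          have y': "y \<in> carrier G" "y \<otimes> inv c i \<in> H" "\<And>j. j \<in> J \<Longrightarrow> y \<otimes> b j = b j \<otimes> y"
            using y by (auto simp: A_def)
          have "h \<otimes> y \<otimes> b j = b j \<otimes> (h \<otimes> y)" if j: "j \<in> J" for j
          proof -
            have "h \<otimes> y \<otimes> b j = h \<otimes> (b j \<otimes> y)"
              using h(1) y'(1) BD(1)[OF b j] y'(3)[OF j] by (simp add: m_assoc)
            also have "\<dots> = (b j \<otimes> h) \<otimes> y"
              using h(1) y'(1) BD(1)[OF b j] h(2)[OF j] by (simp flip: m_assoc)
            finally show ?thesis using h(1) y'(1) BD(1)[OF b j] by (simp add: m_assoc)
          qed
          moreover have "h \<otimes> y \<otimes> inv c i \<in> H"
            using h(1) y'(1,2) cc[OF i] by (simp add: m_assoc)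
          ultimately show "h \<otimes> y \<in> A b" using h(1) y'(1) by (simp add: A_def)
        qed
        show "(\<lambda>z. z \<otimes> inv y) \<in> A b \<rightarrow> {h \<in> H. \<phi> h b = b}"
        proof
          fix z assume z: "z \<in> A b"
          have zy: "z \<in> carrier G" "y \<in> carrier G" using z y by (auto simp: A_def)
          have zH: "z \<otimes> inv y \<in> H"
            by (rule coset_quotient[OF H(1) cc[OF i] zy]) (use z y in \<open>simp_all add: A_def\<close>)
          \<comment> \<open>Conjugation by \<open>z\<close> and by \<open>y\<close> both fix
            \<open>b j\<close>, hence so does conjugation by their quotient.\<close>
          have "(z \<otimes> inv y) \<otimes> b j = b j \<otimes> (z \<otimes> inv y)" if j: "j \<in> J" for j
          proof -
            have bj: "b j \<in> carrier G" by (rule BD(1)[OF b j])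
            have "conjugate G z (b j) = b j" "conjugate G y (b j) = b j"
              using z y j bj by (auto simp: A_def conjugate_eq_iff)
            then have "conjugate G (z \<otimes> inv y) (b j) = b j"
              using bj zy conjugate_conjugate[of "z \<otimes> inv y" y "b j"] by (simp add: m_assoc)
            then show ?thesis using bj zy by (simp add: conjugate_eq_iff)
          qed
          then show "z \<otimes> inv y \<in> {h \<in> H. \<phi> h b = b}" using zH stab by simp
        qed
      qed (use y in \<open>auto simp: A_def m_assoc\<close>)
      then have "card {h \<in> H. \<phi> h b = b} = card (A b)" by (rule bij_betw_same_card)
      then show ?thesis by simp
    qed simp
  qed
  finally show ?thesis by (simp add: J_def)
qed

end

section \<open>Orders of subgroups and gcd arithmetic\<close>

lemma (in group) card_subgroup_dvd:
  assumes "subgroup H G" "subgroup K G" "K \<subseteq> H"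
  shows "card K dvd card H"
proof -
  interpret L: group "G\<lparr>carrier := H\<rparr>" by (rule subgroup_imp_group[OF assms(1)])
  have "subgroup K (G\<lparr>carrier := H\<rparr>)" by (rule subgroup_incl[OF assms(2,1,3)])
  from L.lagrange[OF this] have "card H = card (rcosets\<^bsub>G\<lparr>carrier := H\<rparr>\<^esub> K) * card K"
    by (simp add: order_def)
  then show ?thesis by simp
qed

text \<open>A proper divisor of a prime power misses at least one factor \<open>p\<close>; this is
  used for the order of a proper centralizer.\<close>

lemma prime_power_proper_dvd:
  assumes "Factorial_Ring.prime (p::nat)" "a dvd p ^ k" "a \<noteq> p ^ k"
  shows "p * a dvd p ^ k"
proof -
  obtain l where l: "l \<le> k" "a = p ^ l" using assms by (auto simp: divides_primepow_nat)
  then have "Suc l \<le> k" using assms(3) by (metis le_neq_implies_less Suc_leI)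
  then have "p ^ Suc l dvd p ^ k" by (rule le_imp_power_dvd)
  then show ?thesis using l by simp
qed

text \<open>The arithmetic of one conjugacy class, to be read with \<open>a\<close> the order of
  \<open>H\<close>, \<open>b\<close> the order of a proper centralizer and \<open>w\<close> the size
  of a fibre: the index \<open>a / b\<close> is a multiple of \<open>p\<close> and pays for the
  extra \<open>p\<close> in the gcd.\<close>

lemma gcd_mult_dvd_mult:
  assumes "p * b dvd a" "gcd M b dvd (w::nat)"
  shows "gcd (p * M) a * b dvd w * a"
proof -
  obtain q where q: "a = p * b * q" using assms(1) by blast
  \<comment> \<open>Enlarging the first argument by \<open>q\<close> makes \<open>p * q\<close> a
    common factor that can be pulled out of the gcd.\<close>
  have "gcd (p * M) a dvd gcd (p * q * M) (p * q * b)"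
  proof (rule gcd_greatest)
    have "gcd (p * M) a dvd p * M * q" by (rule dvd_mult2[OF gcd_dvd1])
    then show "gcd (p * M) a dvd p * q * M" by (simp add: mult_ac)
    have "gcd (p * M) a dvd a" by (rule gcd_dvd2)
    then show "gcd (p * M) a dvd p * q * b" by (simp add: q mult_ac)
  qed
  also have "\<dots> = p * q * gcd M b" by (simp add: gcd_mult_distrib_nat)
  also have "\<dots> dvd p * q * w" using assms(2) by (rule mult_dvd_mono[OF dvd_refl])
  finally have "gcd (p * M) a * b dvd p * q * w * b" by (rule mult_dvd_mono) simp
  then show ?thesis by (simp add: q mult_ac)
qed

section \<open>Centralizers, change of base tuple, translation of tuples\<close>

context group
begin

lemma subgroup_centralizer_in:
  assumes "subgroup H G" "x \<in> carrier G"
  shows "subgroup {h \<in> H. h \<otimes> x = x \<otimes> h} G"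
proof -
  interpret H: subgroup H G by fact
  have "{h \<in> H. h \<otimes> x = x \<otimes> h} = {h \<in> H. conjugate G h x = x}"
    using assms(2) by (auto simp: conjugate_eq_iff)
  also have "subgroup \<dots> G"
  proof
    fix h k assume "h \<in> {h \<in> H. conjugate G h x = x}" "k \<in> {h \<in> H. conjugate G h x = x}"
    then show "h \<otimes> k \<in> {h \<in> H. conjugate G h x = x}"
      using assms(2) by (auto simp flip: conjugate_conjugate)
  next
    fix h assume h: "h \<in> {h \<in> H. conjugate G h x = x}"
    then have "conjugate G (inv h) (conjugate G h x) = x"
      using assms(2) by (subst conjugate_conjugate) auto
    then show "inv h \<in> {h \<in> H. conjugate G h x = x}" using h by auto
  next
    show "{h \<in> H. conjugate G h x = x} \<subseteq> carrier G" by auto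
    show "\<one> \<in> {h \<in> H. conjugate G h x = x}" using assms(2) by simp
  qed
  finally show ?thesis .
qed

text \<open>Coordinates of a solution commute with its \<open>i\<close>-th coordinate, hence with
  the power \<open>t i\<close>. So all solutions differ from a chosen one \<open>w\<close> by
  elements centralizing \<open>t i\<close>, and \<open>H\<close> may be replaced by this centralizer
  \<open>K\<close> once \<open>w\<close> is the base. The gain is that \<open>t i\<close> now
  centralizes the new group, as the induction requires.\<close>

lemma commuting_tuples_rebase:
  assumes H: "subgroup H G" and c: "\<And>i. i \<in> I \<Longrightarrow> normalizes G H (c i)"
    and i: "i \<in> I" and w: "w \<in> commuting_tuples G H I c I e t"
    and K: "K = {h \<in> H. h \<otimes> t i = t i \<otimes> h}"
  shows "commuting_tuples G H I c I e t = commuting_tuples G K I w I e t"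
    and "\<And>j. j \<in> I \<Longrightarrow> normalizes G K (w j)"
proof -
  interpret H: subgroup H G by fact
  note D = commuting_tuplesD[OF w]
  have cc: "c j \<in> carrier G" if "j \<in> I" for j using c[OF that] by (simp add: normalizes_def)
  have ti: "t i \<in> carrier G" using D(2)[OF i] D(5)[OF i] by (metis nat_pow_closed)
  have comm: "conjugate G (g j) (t i) = t i"
    if "g \<in> commuting_tuples G H I c I e t" "j \<in> I" for g j
  proof -
    note D' = commuting_tuplesD[OF that(1)]
    have "g j \<otimes> t i = t i \<otimes> g j"
      using commute_pow[OF D'(2)[OF that(2)] D'(2)[OF i] D'(4)[OF that(2) i], of "e i"] D'(5)[OF i] by simp
    then show ?thesis using D'(2)[OF that(2)] ti by (simp add: conjugate_eq_iff)
  qed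
  have K': "K = {h \<in> H. conjugate G h (t i) = t i}"
    using ti by (auto simp: K conjugate_eq_iff)
  show "commuting_tuples G H I c I e t = commuting_tuples G K I w I e t"
  proof (intro equalityI subsetI)
    fix g assume g: "g \<in> commuting_tuples G H I c I e t"
    note D' = commuting_tuplesD[OF g]
    have "g j \<otimes> inv w j \<in> K" if j: "j \<in> I" for j
    proof -
      have "g j \<otimes> inv w j \<in> H"
        by (rule coset_quotient[OF H cc[OF j] D'(2)[OF j] D(2)[OF j] D'(3)[OF j] D(3)[OF j]])
      moreover have "conjugate G (g j \<otimes> inv w j) (t i) = t i"
        using comm[OF g j] comm[OF w j] conjugate_conjugate[of "g j \<otimes> inv w j" "w j" "t i"]
          D'(2)[OF j] D(2)[OF j] ti by (simp add: m_assoc)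
      ultimately show ?thesis by (simp add: K')
    qed
    then show "g \<in> commuting_tuples G K I w I e t"
      using D' by (intro commuting_tuplesI) (auto simp: PiE_def)
  next
    \<comment> \<open>The converse inclusion holds because \<open>K\<close> lies in \<open>H\<close>
      and \<open>w j\<close> lies in the coset of \<open>c j\<close>.\<close>
    fix g assume g: "g \<in> commuting_tuples G K I w I e t"
    note D' = commuting_tuplesD[OF g]
    have "g j \<otimes> inv c j \<in> H" if j: "j \<in> I" for j
    proof -
      have "g j \<otimes> inv c j = (g j \<otimes> inv w j) \<otimes> (w j \<otimes> inv c j)"
        using D'(2)[OF j] D(2)[OF j] cc[OF j] by (simp add: m_assoc)
      then show ?thesis using D'(3)[OF j] D(3)[OF j] by (simp add: K)
    qed
    then show "g \<in> commuting_tuples G H I c I e t"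
      using D' by (intro commuting_tuplesI) (auto simp: PiE_def)
  qed
  show "normalizes G K (w j)" if j: "j \<in> I" for j
  proof -
    have n: "normalizes G H (w j)" by (rule normalizes_coset[OF H c[OF j] D(2)[OF j] D(3)[OF j]])
    have "conjugate G (conjugate G (w j) h) (t i) = t i" if "h \<in> K" for h
    proof -
      have h: "h \<in> carrier G" "conjugate G h (t i) = t i" using that by (auto simp: K')
      have wi: "conjugate G (inv (w j)) (t i) = t i"
        using comm[OF w j] conjugate_conjugate[of "inv (w j)" "w j" "t i"] D(2)[OF j] ti by simp
      \<comment> \<open>Conjugation by a conjugate of \<open>h\<close> is a composite of three
        conjugations, each of which fixes \<open>t i\<close>.\<close>
      have "conjugate G (conjugate G (w j) h) (t i)
        = conjugate G (w j) (conjugate G h (conjugate G (inv (w j)) (t i)))"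
        using D(2)[OF j] h(1) ti by (simp add: conjugate_def m_assoc inv_mult_group)
      then show ?thesis by (simp only: wi h(2) comm[OF w j])
    qed
    then show ?thesis using n by (auto simp: normalizes_def K')
  qed
qed

text \<open>The quotient \<open>u\<close> of the tuples \<open>g\<close> and \<open>w\<close> is a
  cocycle for the action of \<open>w\<close> on \<open>H\<close>. As \<open>H\<close> is abelian,
  all elements of one coset act on \<open>H\<close> alike, so \<open>u\<close> is a cocycle for
  \<open>h\<close> too and its norms do not change. Hence multiplying \<open>h\<close> by
  \<open>u\<close> gives a commuting tuple and shifts each power by the quotient of the targets of
  \<open>g\<close> and \<open>w\<close>.\<close>

lemma commuting_tuples_translate:
  assumes H: "subgroup H G" and c: "\<And>j. j \<in> I \<Longrightarrow> normalizes G H (c j)"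
    and ab: "\<And>h k. \<lbrakk>h \<in> H; k \<in> H\<rbrakk> \<Longrightarrow> h \<otimes> k = k \<otimes> h"
    and w: "w \<in> commuting_tuples G H I c I e s"
    and g: "g \<in> commuting_tuples G H I c I e s'"
    and h: "h \<in> commuting_tuples G H I c I e t"
  shows "(\<lambda>j\<in>I. g j \<otimes> inv w j \<otimes> h j) \<in> commuting_tuples G H I c I e (\<lambda>j. s' j \<otimes> inv s j \<otimes> t j)"
proof -
  interpret H: subgroup H G by fact
  note W = commuting_tuplesD[OF w] and D = commuting_tuplesD[OF g] and T = commuting_tuplesD[OF h]
  define u where "u j = g j \<otimes> inv w j" for j
  have cc: "c j \<in> carrier G" if "j \<in> I" for j using c[OF that] by (simp add: normalizes_def)
  have u: "u j \<in> H" if j: "j \<in> I" for j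
    unfolding u_def by (rule coset_quotient[OF H cc[OF j] D(2)[OF j] W(2)[OF j] D(3)[OF j] W(3)[OF j]])
  have g_eq: "g j = u j \<otimes> w j" if "j \<in> I" for j
    using D(2)[OF that] W(2)[OF that] by (simp add: u_def m_assoc)
  have nw: "conjugate G (w j) k \<in> H" if "j \<in> I" "k \<in> H" for j k
    using normalizes_coset[OF H c[OF that(1)] W(2)[OF that(1)] W(3)[OF that(1)]] that by (simp add: normalizes_def)
  \<comment> \<open>\<open>h j\<close> and \<open>w j\<close> differ by an element of
    \<open>H\<close>, which acts trivially on the abelian group \<open>H\<close>.\<close>
  have same: "conjugate G (h j) k = conjugate G (w j) k" if j: "j \<in> I" and k: "k \<in> H" for j k
  proof -
    have r: "h j \<otimes> inv w j \<in> H"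
      by (rule coset_quotient[OF H cc[OF j] T(2)[OF j] W(2)[OF j] T(3)[OF j] W(3)[OF j]])
    have "conjugate G (h j) k = conjugate G (h j \<otimes> inv w j) (conjugate G (w j) k)"
      using k T(2)[OF j] W(2)[OF j] by (simp add: conjugate_conjugate m_assoc)
    also have "\<dots> = conjugate G (w j) k"
      using ab[OF r nw[OF j k]] r nw[OF j k] by (simp add: conjugate_eq_iff)
    finally show ?thesis .
  qed
  have expand: "(u i \<otimes> x) \<otimes> (u j \<otimes> y) = (u i \<otimes> conjugate G x (u j)) \<otimes> (x \<otimes> y)"
    if "i \<in> I" "j \<in> I" "x \<in> carrier G" "y \<in> carrier G" for i j x y
    using that u[OF that(1)] u[OF that(2)] by (simp add: conjugate_def m_assoc)
  \<comment> \<open>Commutation of \<open>g i\<close> with \<open>g j\<close>, after cancelling the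
    common right factor \<open>w i \<otimes> w j\<close>.\<close>
  have cocycle: "u i \<otimes> conjugate G (w i) (u j) = u j \<otimes> conjugate G (w j) (u i)"
    if i: "i \<in> I" and j: "j \<in> I" for i j
  proof -
    have "(u i \<otimes> conjugate G (w i) (u j)) \<otimes> (w i \<otimes> w j) = (u j \<otimes> conjugate G (w j) (u i)) \<otimes> (w i \<otimes> w j)"
      using D(4)[OF i j] W(4)[OF i j] expand[OF i j W(2)[OF i] W(2)[OF j]] expand[OF j i W(2)[OF j] W(2)[OF i]]
      by (simp add: g_eq i j)
    then show ?thesis using u nw W(2) i j by (simp add: H.mem_carrier)
  qed
  \<comment> \<open>The norm of \<open>u j\<close>, the product of its successive conjugates, is the
    same element of \<open>H\<close> whether computed along \<open>w j\<close> or along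
    \<open>h j\<close>.\<close>
  have norm: "(u j \<otimes> h j) [^] m = (u j \<otimes> w j) [^] m \<otimes> inv (w j [^] m) \<otimes> h j [^] m \<and>
      (u j \<otimes> w j) [^] m \<otimes> inv (w j [^] m) \<in> H" if j: "j \<in> I" for j and m :: nat
  proof (induction m)
    case 0
    then show ?case by simp
  next
    case (Suc m)
    define k where "k = (u j \<otimes> w j) [^] m \<otimes> inv (w j [^] m)"
    have k: "k \<in> H" using Suc by (simp add: k_def)
    have uw: "(u j \<otimes> w j) [^] m = k \<otimes> w j [^] m"
      using u[OF j] W(2)[OF j] by (simp add: k_def m_assoc)
    have uh: "(u j \<otimes> h j) [^] m = k \<otimes> h j [^] m" using Suc by (simp add: k_def)
    \<comment> \<open>The recursion of the norm: conjugate the previous value by \<open>x\<close>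
      and multiply by \<open>u j\<close> on the left.\<close>
    have step: "(u j \<otimes> x) [^] Suc m = u j \<otimes> conjugate G x k \<otimes> x [^] Suc m"
      if "(u j \<otimes> x) [^] m = k \<otimes> x [^] m" "x \<in> carrier G" for x
    proof -
      have "(u j \<otimes> x) [^] Suc m = (u j \<otimes> x) \<otimes> (k \<otimes> x [^] m)"
        using that u[OF j] by (subst nat_pow_Suc2) simp_all
      also have "\<dots> = u j \<otimes> conjugate G x k \<otimes> (x \<otimes> x [^] m)"
        using that u[OF j] k by (simp add: conjugate_def m_assoc)
      finally show ?thesis using that by (simp only: nat_pow_Suc2)
    qed
    have "(u j \<otimes> w j) [^] Suc m \<otimes> inv (w j [^] Suc m) = u j \<otimes> conjugate G (w j) k"
      unfolding step[OF uw W(2)[OF j]] using u[OF j] W(2)[OF j] k by (simp add: m_assoc del: nat_pow_Suc)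
    then show ?case
      using step[OF uh T(2)[OF j]] same[OF j k] u[OF j] nw[OF j k] by simp
  qed
  have "(\<lambda>j\<in>I. u j \<otimes> h j) \<in> commuting_tuples G H I c I e (\<lambda>j. s' j \<otimes> inv s j \<otimes> t j)"
  proof (rule commuting_tuplesI)
    show "(\<lambda>j\<in>I. u j \<otimes> h j) j \<in> carrier G" if "j \<in> I" for j using that u T(2) by simp
    show "(\<lambda>j\<in>I. u j \<otimes> h j) j \<otimes> inv c j \<in> H" if "j \<in> I" for j
      using that u[OF that] T(2,3)[OF that] cc[OF that] by (simp add: m_assoc)
    show "(\<lambda>j\<in>I. u j \<otimes> h j) i \<otimes> (\<lambda>j\<in>I. u j \<otimes> h j) j = (\<lambda>j\<in>I. u j \<otimes> h j) j \<otimes> (\<lambda>j\<in>I. u j \<otimes> h j) i"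
      if i: "i \<in> I" and j: "j \<in> I" for i j
      using i j expand[OF i j T(2)[OF i] T(2)[OF j]] expand[OF j i T(2)[OF j] T(2)[OF i]]
        same[OF i u[OF j]] same[OF j u[OF i]] cocycle[OF i j] T(4)[OF i j] by simp
    show "(\<lambda>j\<in>I. u j \<otimes> h j) j [^] e j = s' j \<otimes> inv s j \<otimes> t j" if j: "j \<in> I" for j
      using norm[OF j, of "e j"] j D(5)[OF j] W(5)[OF j] T(5)[OF j] by (simp flip: g_eq)
  qed simp
  then show ?thesis by (simp add: u_def)
qed

end

section \<open>Counting commuting tuples\<close>

context group
begin

text \<open>The form that survives the induction: targets centralizing \<open>H\<close> appear when
  an exponent is lowered, arbitrary normalizing base points appear when the tuples are rebased, and
  the condition on centers speaks of all subgroups of \<open>H\<close>, so it passes to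
  centralizers.\<close>

lemma card_commuting_tuples_dvd:
  fixes c :: "'i \<Rightarrow> 'a"
  assumes p: "Factorial_Ring.prime p" and I: "finite I"
    and "subgroup H G" "finite H" "card H = p ^ k"
    and "\<And>K. \<lbrakk>subgroup K G; K \<subseteq> H; \<exists>x\<in>K. \<exists>y\<in>K. x \<otimes> y \<noteq> y \<otimes> x\<rbrakk>
      \<Longrightarrow> \<forall>z\<in>K. (\<forall>x\<in>K. z \<otimes> x = x \<otimes> z) \<longrightarrow> z [^] p = \<one>"
    and "\<And>i. i \<in> I \<Longrightarrow> normalizes G H (c i)"
    and "\<And>i. i \<in> I \<Longrightarrow> t i \<in> carrier G"
    and "\<And>i h. \<lbrakk>i \<in> I; h \<in> H\<rbrakk> \<Longrightarrow> h \<otimes> t i = t i \<otimes> h"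
  shows "gcd (p ^ sum n I) (card H) dvd card (commuting_tuples G H I c I (\<lambda>i. p ^ n i) t)"
  using assms(3-)
proof (induction "sum n I" arbitrary: H k n c t)
  case 0
  then show ?case by simp
next
  case (Suc N n H k c t)
  note IH = Suc.hyps(1) and H = Suc.prems(1,2) and cardH = Suc.prems(3)
    and center = Suc.prems(4) and c = Suc.prems(5) and t = Suc.prems(6) and tH = Suc.prems(7)
  interpret H: subgroup H G by fact
  obtain i where i: "i \<in> I" "n i > 0"
    using Suc.hyps(2) by (metis bot_nat_0.not_eq_extremum nat.distinct(1) sum.neutral)
  then obtain m where m: "n i = Suc m" using gr0_implies_Suc by blast
  \<comment> \<open>Lowering the exponent of the coordinate \<open>i\<close> by one lowers the total
    by one, so the induction hypothesis covers the sets \<open>W x\<close> below.\<close>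
  have N: "N = sum (n(i := m)) I"
    using Suc.hyps(2) I i m by (simp add: sum.remove[of I i])
  define d where "d = gcd (p ^ sum n I) (card H)"
  have d: "d = gcd (p * p ^ N) (card H)" by (simp add: d_def flip: Suc.hyps(2))

  \<comment> \<open>Fibres of the p^m-th power of the i-th coordinate\<close>
  define T where "T = commuting_tuples G H I c I (\<lambda>i. p ^ n i) t"
  define Y where "Y = commuting_tuples G H I c (I - {i}) (\<lambda>i. p ^ n i) t"
  define W where "W x = commuting_tuples G H I c I (\<lambda>j. p ^ (n(i := m)) j) (t(i := x))" for x
  define r where "r g = g i [^] (p ^ m)" for g :: "'i \<Rightarrow> 'a"
  define S where "S = r ` Y"
  have cc: "c j \<in> carrier G" if "j \<in> I" for j using c[OF that] by (simp add: normalizes_def)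
  have finY: "finite Y" unfolding Y_def by (rule finite_commuting_tuples[OF I H(2) cc])
  have finS: "finite S" using finY by (simp add: S_def)
  have Yi: "g i \<in> carrier G" "g i \<otimes> inv c i \<in> H" if "g \<in> Y" for g
    using commuting_tuplesD(2,3)[OF that[unfolded Y_def] i(1)] .
  have S_carrier: "x \<in> carrier G" if "x \<in> S" for x
    using that Yi by (auto simp: S_def r_def)
  have W_eq: "W x = {g \<in> Y. r g = x}" for x
    unfolding W_def Y_def r_def commuting_tuples_def using i(1)
    by (auto split: if_splits)
  \<comment> \<open>The exponent \<open>p ^ Suc m\<close> is reached by one further
    \<open>p\<close>-th power of \<open>r g\<close>.\<close>
  have T_eq: "T = {g \<in> Y. r g [^] p = t i}"
  proof -
    have "r g [^] p = g i [^] (p ^ n i)" if "g i \<in> carrier G" for g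
      using that by (simp add: r_def nat_pow_pow m mult.commute)
    then show ?thesis
      unfolding T_def Y_def commuting_tuples_def using i(1) by (auto simp: PiE_iff)
  qed
  have sum_W: "card {g \<in> Y. P (r g)} = (\<Sum>x | x \<in> S \<and> P x. card (W x))" for P
  proof -
    have "card {g \<in> Y. P (r g)} = (\<Sum>x\<in>r ` {g \<in> Y. P (r g)}. card {g. g \<in> {g \<in> Y. P (r g)} \<and> r g = x})"
      using sum.image_gen[of "{g \<in> Y. P (r g)}" "\<lambda>_. 1::nat" r] finY by simp
    also have "\<dots> = (\<Sum>x | x \<in> S \<and> P x. card (W x))"
      by (rule sum.cong) (auto simp: S_def W_eq intro!: arg_cong[where f = card])
    finally show ?thesis .
  qed
  have card_Y: "card H dvd card Y"
    unfolding Y_def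
    by (rule card_dvd_card_commuting_tuples[where c = c, OF I H c i(1)]) (use t tH in \<open>simp_all add: conjugate_eq_iff\<close>)
  \<comment> \<open>Conjugation by \<open>h\<close> fixes the other targets, which centralize
    \<open>H\<close>, and moves only the target \<open>x\<close> at \<open>i\<close>.\<close>
  have W_conj: "card (W (conjugate G h x)) = card (W x)" if h: "h \<in> H" and x: "x \<in> carrier G" for h x
  proof -
    have "W (conjugate G h x) = commuting_tuples G H I c I (\<lambda>j. p ^ (n(i := m)) j)
        (\<lambda>j. conjugate G h ((t(i := x)) j))"
      unfolding W_def using h t tH by (intro commuting_tuples_cong) (auto simp: conjugate_eq_iff[THEN iffD2])
    then show ?thesis
      unfolding W_def using card_conjugate_commuting_tuples[where c = c, OF I H c h order.refl, where t = "t(i := x)"] t x by auto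
  qed
  \<comment> \<open>Values are exactly the elements with a nonempty fibre, so every operation that
    preserves fibre sizes preserves \<open>S\<close>.\<close>
  have S_iff: "x \<in> S \<longleftrightarrow> x \<in> carrier G \<and> card (W x) > 0" for x
  proof -
    have "finite (W x)" using finY by (simp add: W_eq)
    then show ?thesis using S_carrier by (auto simp: S_def W_eq card_gt_0_iff)
  qed
  have S_conj: "conjugate G h x \<in> S" if "h \<in> H" "x \<in> S" for h x
    using that W_conj[OF that(1), of x] by (simp add: S_iff)
  \<comment> \<open>Rebase at a tuple \<open>w\<close> of the fibre: over the centralizer
    \<open>K\<close> of \<open>x\<close> all targets are centralized, and the induction hypothesis
    applies.\<close>
  have W_dvd: "gcd (p ^ N) (card {h \<in> H. h \<otimes> x = x \<otimes> h}) dvd card (W x)" if x: "x \<in> S" for x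
  proof -
    define K where "K = {h \<in> H. h \<otimes> x = x \<otimes> h}"
    obtain w where w: "w \<in> W x" using x by (auto simp: S_def W_eq)
    have K: "subgroup K G" unfolding K_def by (rule subgroup_centralizer_in[OF H(1) S_carrier[OF x]])
    have KH: "K \<subseteq> H" by (auto simp: K_def)
    have K_eq: "K = {h \<in> H. h \<otimes> (t(i := x)) i = (t(i := x)) i \<otimes> h}" by (simp add: K_def)
    have R: "W x = commuting_tuples G K I w I (\<lambda>j. p ^ (n(i := m)) j) (t(i := x))"
      "\<And>j. j \<in> I \<Longrightarrow> normalizes G K (w j)"
      unfolding W_def
      using commuting_tuples_rebase[where c = c, OF H(1) _ i(1) w[unfolded W_def] K_eq] c by blast+
    have "card K dvd p ^ k" using card_subgroup_dvd[OF H(1) K KH] cardH by simp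
    then obtain l where l: "card K = p ^ l" using p by (auto simp: divides_primepow_nat)
    have "gcd (p ^ sum (n(i := m)) I) (card K)
        dvd card (commuting_tuples G K I w I (\<lambda>j. p ^ (n(i := m)) j) (t(i := x)))"
    proof (rule IH[OF N K _ l])
      show "finite K" using KH H(2) by (rule finite_subset)
      show "\<forall>z\<in>L. (\<forall>x\<in>L. z \<otimes> x = x \<otimes> z) \<longrightarrow> z [^] p = \<one>"
        if "subgroup L G" "L \<subseteq> K" "\<exists>x\<in>L. \<exists>y\<in>L. x \<otimes> y \<noteq> y \<otimes> x" for L
        using center[OF that(1) _ that(3)] that(2) KH by blast
      show "normalizes G K (w j)" if "j \<in> I" for j by (rule R(2)[OF that])
      show "(t(i := x)) j \<in> carrier G" if "j \<in> I" for j using t S_carrier[OF x] that by simp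
      show "h \<otimes> (t(i := x)) j = (t(i := x)) j \<otimes> h" if "j \<in> I" "h \<in> K" for j h
        using that tH by (auto simp: K_def)
    qed
    then show ?thesis using R(1) N by (simp add: K_def)
  qed

  \<comment> \<open>Values that do not centralize H\<close>
  have noncentral: "d dvd (\<Sum>x\<in>S'. card (W x))"
    if S': "S' \<subseteq> S" "\<And>h x. \<lbrakk>h \<in> H; x \<in> S'\<rbrakk> \<Longrightarrow> conjugate G h x \<in> S'"
      and nc: "\<And>x. x \<in> S' \<Longrightarrow> \<exists>h\<in>H. h \<otimes> x \<noteq> x \<otimes> h" for S'
  proof (rule orbit_weighted_sum_dvd[OF H, where \<phi> = "conjugate G"])
    show "finite S'" using S'(1) finS by (rule finite_subset)
    fix x assume x: "x \<in> S'"
    then have xc: "x \<in> carrier G" using S' S_carrier by blast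
    show "conjugate G \<one> x = x" using xc by simp
    show "conjugate G h x \<in> S'" if "h \<in> H" for h using S'(2)[OF that x] .
    show "conjugate G h (conjugate G h' x) = conjugate G (h \<otimes> h') x" if "h \<in> H" "h' \<in> H" for h h'
      using that xc by (simp add: conjugate_conjugate)
    show "card (W (conjugate G h x)) = card (W x)" if "h \<in> H" for h by (rule W_conj[OF that xc])
    define K where "K = {h \<in> H. h \<otimes> x = x \<otimes> h}"
    have K: "subgroup K G" unfolding K_def by (rule subgroup_centralizer_in[OF H(1) xc])
    \<comment> \<open>Properness of the centralizer is where the missing factor \<open>p\<close>
      comes from.\<close>
    have "K \<subset> H" using nc[OF x] by (auto simp: K_def)
    then have "card K \<noteq> p ^ k" "card K dvd p ^ k"
      using psubset_card_mono[OF H(2), of K] card_subgroup_dvd[OF H(1) K] cardH by simp_all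
    then have "p * card K dvd card H" using prime_power_proper_dvd[OF p] cardH by simp
    then have "d * card K dvd card (W x) * card H"
      unfolding d by (rule gcd_mult_dvd_mult) (use W_dvd x S' in \<open>auto simp: K_def\<close>)
    also have "K = {h \<in> H. conjugate G h x = x}" using xc by (auto simp: K_def conjugate_eq_iff)
    finally show "d * card {h \<in> H. conjugate G h x = x} dvd card (W x) * card H" .
  qed

  \<comment> \<open>Values that centralize H\<close>
  define C where "C = {x \<in> S. \<forall>h\<in>H. h \<otimes> x = x \<otimes> h}"
  have C_conj: "conjugate G h x \<in> C \<longleftrightarrow> x \<in> C" if h: "h \<in> H" and x: "x \<in> S" for h x
  proof -
    have fixed: "y \<in> C \<longleftrightarrow> (\<forall>k\<in>H. conjugate G k y = y)" if "y \<in> S" for y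
      using that S_carrier[OF that] by (auto simp: C_def conjugate_eq_iff)
    show ?thesis
    proof
      assume "conjugate G h x \<in> C"
      then have "conjugate G (inv h) (conjugate G h x) = conjugate G h x"
        using fixed[OF S_conj[OF h x]] h by simp
      then show "conjugate G h x \<in> C \<Longrightarrow> x \<in> C"
        using S_carrier[OF x] h by (simp add: conjugate_conjugate)
    next
      assume "x \<in> C"
      then show "conjugate G h x \<in> C" using fixed[OF x] h by simp
    qed
  qed
  have noncentral_P: "d dvd (\<Sum>x | x \<in> S \<and> x \<notin> C \<and> P x. card (W x))"
    if P: "\<And>h x. \<lbrakk>h \<in> H; x \<in> S; P x\<rbrakk> \<Longrightarrow> P (conjugate G h x)" for P
  proof (rule noncentral)
    show "conjugate G h x \<in> {x. x \<in> S \<and> x \<notin> C \<and> P x}"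
      if "h \<in> H" "x \<in> {x. x \<in> S \<and> x \<notin> C \<and> P x}" for h x
      using that S_conj C_conj P by simp
  qed (auto simp: C_def)
  have pow_conj: "conjugate G h x [^] p = t i" if "h \<in> H" "x \<in> S" "x [^] p = t i" for h x
    using that S_carrier[OF that(2)] t[OF i(1)] tH[OF i(1)]
    by (simp add: conjugate_eq_iff flip: conjugate_pow)
  have split: "(\<Sum>x | x \<in> S \<and> P x. card (W x)) =
      (\<Sum>x | x \<in> S \<and> x \<notin> C \<and> P x. card (W x)) + (\<Sum>x | x \<in> C \<and> P x. card (W x))" for P
    by (subst sum.union_disjoint[symmetric]) (use finS in \<open>auto simp: C_def intro!: sum.cong\<close>)
  have dY: "d dvd card Y" using card_Y by (auto simp: d_def intro: dvd_trans[OF gcd_dvd2])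
  \<comment> \<open>The sum over all values is \<open>card Y\<close>, a multiple of
    \<open>card H\<close>; subtracting the noncentral part leaves the sum over
    \<open>C\<close>.\<close>
  have C_dvd: "d dvd (\<Sum>x | x \<in> C. card (W x))"
    using dY sum_W[of "\<lambda>_. True"] split[of "\<lambda>_. True"] noncentral_P[of "\<lambda>_. True"]
    by (simp add: dvd_add_right_iff)
  \<comment> \<open>All values lie in the single coset of \<open>c i [^] (p ^ m)\<close>.\<close>
  have diff: "x \<otimes> inv y \<in> H" if xy: "x \<in> S" "y \<in> S" for x y
  proof -
    have "r g \<otimes> inv (c i [^] (p ^ m)) \<in> H" if "g \<in> Y" for g
      unfolding r_def by (rule coset_pow[OF H(1) c[OF i(1)] Yi(1)[OF that] Yi(2)[OF that]])
    then have "x \<otimes> inv (c i [^] (p ^ m)) \<in> H" if "x \<in> S" for x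
      using that by (auto simp: S_def)
    then show ?thesis
      using xy S_carrier cc[OF i(1)] by (simp add: coset_quotient[OF H(1), of "c i [^] (p ^ m)"])
  qed
  \<comment> \<open>If the condition on \<open>p\<close>-th powers does not distinguish elements of
    \<open>C\<close>, the sum is the full sum over \<open>C\<close> or empty.\<close>
  have all_or_none: "d dvd (\<Sum>x | x \<in> C \<and> x [^] p = t i. card (W x))"
    if *: "\<And>x y. \<lbrakk>x \<in> C; y \<in> C; x [^] p = t i\<rbrakk> \<Longrightarrow> y [^] p = t i"
  proof (cases "\<exists>x\<in>C. x [^] p = t i")
    case True
    then obtain x where x: "x \<in> C" "x [^] p = t i" by blast
    have "{y. y \<in> C \<and> y [^] p = t i} = {y. y \<in> C}" using *[OF x(1) _ x(2)] by blast
    then show ?thesis using C_dvd by (simp only:)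
  next
    case False
    then have "{x. x \<in> C \<and> x [^] p = t i} = {}" by blast
    then show ?thesis by (simp only: sum.empty dvd_0_right)
  qed
  have "d dvd (\<Sum>x | x \<in> C \<and> x [^] p = t i. card (W x))"
  proof (cases "\<exists>x\<in>H. \<exists>y\<in>H. x \<otimes> y \<noteq> y \<otimes> x")
    case True
    \<comment> \<open>The quotient \<open>v\<close> of two values in \<open>C\<close> is a central
      element of the non-abelian group \<open>H\<close>, so its \<open>p\<close>-th power is
      trivial; it also commutes with \<open>y\<close>.\<close>
    have "x [^] p = y [^] p" if x: "x \<in> C" and y: "y \<in> C" for x y
    proof -
      define v where "v = x \<otimes> inv y"
      have xy: "x \<in> S" "y \<in> S" "x \<in> carrier G" "y \<in> carrier G"
        using x y S_carrier by (auto simp: C_def)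
      have v: "v \<in> H" using diff xy by (simp add: v_def)
      have x_eq: "x = v \<otimes> y" using xy by (simp add: v_def m_assoc)
      have "v \<otimes> h = h \<otimes> v" if h: "h \<in> H" for h
      proof -
        have "conjugate G y h = h" "conjugate G x h = h"
          using h x y xy by (auto simp: C_def conjugate_eq_iff)
        then have "conjugate G v h = h"
          using h xy conjugate_conjugate[of v y h] v x_eq by simp
        then show ?thesis using h v by (simp add: conjugate_eq_iff)
      qed
      then have "v [^] p = \<one>" using center[OF H(1) order.refl True] v by blast
      moreover have "v \<otimes> y = y \<otimes> v" using y v by (auto simp: C_def)
      ultimately show ?thesis
        unfolding x_eq using v xy by (simp add: pow_mult_distrib)
    qed
    then show ?thesis by - (rule all_or_none, metis)
  next
    case False
    then have ab: "h \<otimes> k = k \<otimes> h" if "h \<in> H" "k \<in> H" for h k using that by blast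
    show ?thesis
    proof (cases "\<exists>x0\<in>C. \<exists>x1\<in>C. x0 [^] p = t i \<and> x1 \<noteq> x0")
      case False
      \<comment> \<open>Here either no element of \<open>C\<close> satisfies the condition or
        \<open>C\<close> is a singleton.\<close>
      show ?thesis by (rule all_or_none) (use False in metis)
    next
      case True
      then obtain x0 x1 where x01: "x0 \<in> C" "x1 \<in> C" "x1 \<noteq> x0" by blast
      then have x01_S: "x0 \<in> S" "x1 \<in> S" by (auto simp: C_def)
      \<comment> \<open>Each value is an element of the abelian group \<open>H\<close> times
        \<open>x0\<close>, and both factors are centralized by \<open>H\<close>; so \<open>S\<close>
        and \<open>C\<close> coincide.\<close>
      have C_eq: "x \<in> C" if x: "x \<in> S" for x
      proof -
        define v where "v = x \<otimes> inv x0"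
        have v: "v \<in> H" unfolding v_def by (rule diff[OF x x01_S(1)])
        have x_eq: "x = v \<otimes> x0" using S_carrier x x01_S by (simp add: v_def m_assoc)
        have "conjugate G h x = x" if h: "h \<in> H" for h
        proof -
          have "conjugate G h v = v" using ab[OF h v] h v by (simp add: conjugate_eq_iff)
          moreover have "conjugate G h x0 = x0"
            using x01(1) h S_carrier[OF x01_S(1)] by (auto simp: C_def conjugate_eq_iff)
          ultimately show ?thesis
            using h v S_carrier[OF x01_S(1)] by (simp add: x_eq conjugate_mult)
        qed
        then show ?thesis using x S_carrier[OF x] by (auto simp: C_def conjugate_eq_iff)
      qed
      define v where "v = x1 \<otimes> inv x0"
      have v: "v \<in> H" unfolding v_def by (rule diff[OF x01_S(2,1)])
      have v_ne: "v \<noteq> \<one>"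
        using x01(3) S_carrier[OF x01_S(1)] S_carrier[OF x01_S(2)] by (simp add: v_def mult_inv_eq_iff)
      obtain w0 w1 where w01: "w0 \<in> W x0" "w1 \<in> W x1" using x01_S by (auto simp: S_def W_eq)
      have finW: "finite (W x)" for x using finY by (simp add: W_eq)
      \<comment> \<open>Translation by the quotient of a tuple over \<open>x1\<close> and a tuple
        over \<open>x0\<close> maps the fibre over \<open>x\<close> injectively into the fibre over
        \<open>v \<otimes> x\<close>.\<close>
      have le: "card (W x) \<le> card (W (v \<otimes> x))" if x: "x \<in> carrier G" for x
      proof (rule card_inj_on_le[OF _ _ finW])
        show "(\<lambda>h. \<lambda>j\<in>I. w1 j \<otimes> inv w0 j \<otimes> h j) ` W x \<subseteq> W (v \<otimes> x)"
        proof (rule image_subsetI)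
          fix h assume "h \<in> W x"
          then have "(\<lambda>j\<in>I. w1 j \<otimes> inv w0 j \<otimes> h j) \<in> commuting_tuples G H I c I (\<lambda>j. p ^ (n(i := m)) j)
              (\<lambda>j. (t(i := x1)) j \<otimes> inv (t(i := x0)) j \<otimes> (t(i := x)) j)"
            using w01 unfolding W_def by (intro commuting_tuples_translate[where c = c, OF H(1) c ab])
          also have "\<dots> = W (v \<otimes> x)"
            unfolding W_def using t by (intro commuting_tuples_cong) (auto simp: v_def)
          finally show "(\<lambda>j\<in>I. w1 j \<otimes> inv w0 j \<otimes> h j) \<in> W (v \<otimes> x)" .
        qed
        show "inj_on (\<lambda>h. \<lambda>j\<in>I. w1 j \<otimes> inv w0 j \<otimes> h j) (W x)"
        proof (rule inj_onI)
          fix h h' assume h: "h \<in> W x" "h' \<in> W x"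
            and eq: "(\<lambda>j\<in>I. w1 j \<otimes> inv w0 j \<otimes> h j) = (\<lambda>j\<in>I. w1 j \<otimes> inv w0 j \<otimes> h' j)"
          have Wc: "g j \<in> carrier G" if "g \<in> W x" "j \<in> I" for g x j
            using commuting_tuplesD(2) that unfolding W_def by fast
          show "h = h'"
          proof (rule PiE_ext)
            show "h \<in> I \<rightarrow>\<^sub>E carrier G" "h' \<in> I \<rightarrow>\<^sub>E carrier G"
              using h commuting_tuplesD(1) unfolding W_def by blast+
            fix j assume j: "j \<in> I"
            then have "w1 j \<otimes> inv w0 j \<otimes> h j = w1 j \<otimes> inv w0 j \<otimes> h' j" using fun_cong[OF eq, of j] by simp
            then show "h j = h' j"
              using Wc[OF w01(1) j] Wc[OF w01(2) j] Wc[OF h(1) j] Wc[OF h(2) j] by simp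
          qed
        qed
      qed
      have le_pow: "card (W x) \<le> card (W (v [^] a \<otimes> x))" if x: "x \<in> carrier G" for x and a :: nat
      proof (induction a)
        case (Suc a)
        have "v [^] Suc a \<otimes> x = v \<otimes> (v [^] a \<otimes> x)"
          using x v by (subst nat_pow_Suc2) (simp_all add: m_assoc)
        then show ?case using Suc le[of "v [^] a \<otimes> x"] x v by (simp del: nat_pow_Suc)
      qed (use x in simp)
      have v_pow: "v [^] (p ^ k) = \<one>"
      proof -
        interpret L: group "G\<lparr>carrier := H\<rparr>" by (rule subgroup_imp_group[OF H(1)])
        have "v [^]\<^bsub>G\<lparr>carrier := H\<rparr>\<^esub> order (G\<lparr>carrier := H\<rparr>) = \<one>"
          using L.pow_order_eq_1[of v] v by simp
        then show ?thesis using cardH nat_pow_consistent by (simp add: order_def)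
      qed
      \<comment> \<open>As \<open>v\<close> has finite order, further translations lead back to
        \<open>x\<close>, so the inequalities become equalities.\<close>
      have W_pow: "card (W (v [^] a \<otimes> x)) = card (W x)" if x: "x \<in> carrier G" for x and a :: nat
      proof (rule antisym)
        \<comment> \<open>Positivity makes the subtraction in \<open>p ^ k - 1\<close>
          genuine.\<close>
        have q: "0 < p ^ k" using p by (simp add: prime_gt_0_nat)
        have "v [^] (a * (p ^ k - 1)) \<otimes> (v [^] a \<otimes> x) = v [^] (a * p ^ k) \<otimes> x"
        proof -
          have "a * (p ^ k - 1) + a = a * p ^ k" using q by (cases "p ^ k") simp_all
          then show ?thesis using x v by (simp add: nat_pow_mult flip: m_assoc)
        qed
        also have "v [^] (a * p ^ k) = \<one>"
          using v v_pow by (metis H.mem_carrier mult.commute nat_pow_one nat_pow_pow)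
        finally show "card (W (v [^] a \<otimes> x)) \<le> card (W x)"
          using le_pow[of "v [^] a \<otimes> x" "a * (p ^ k - 1)"] x v by simp
      qed (rule le_pow[OF x])
      \<comment> \<open>The last nontrivial iterated \<open>p\<close>-th power of \<open>v\<close>;
        it has order \<open>p\<close>. The least \<open>L\<close> with trivial power is nonzero
        because \<open>v\<close> is not \<open>\<one>\<close>.\<close>
      obtain l where l: "v [^] (p ^ l) \<noteq> \<one>" "v [^] (p ^ Suc l) = \<one>"
      proof -
        define L where "L = (LEAST l. v [^] (p ^ l) = \<one>)"
        have L: "v [^] (p ^ L) = \<one>" unfolding L_def by (rule LeastI[of _ k]) (rule v_pow)
        have "L \<noteq> 0"
        proof
          assume "L = 0"
          then show False using L v_ne v by simp
        qed
        then obtain l where "L = Suc l" using not0_implies_Suc by blast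
        then show ?thesis using L not_less_Least[of l "\<lambda>l. v [^] (p ^ l) = \<one>"] that by (auto simp: L_def)
      qed
      define u where "u = v [^] (p ^ l)"
      have "v [^] a \<in> H" for a :: nat by (induction a) (use v in simp_all)
      then have u: "u \<in> H" "u \<in> carrier G" "u \<noteq> \<one>" using l(1) by (simp_all add: u_def)
      have u_pow: "u [^] p = \<one>" using l v by (simp add: u_def nat_pow_pow mult.commute)
      have ord_u: "ord u = p"
      proof -
        have "ord u dvd p" using u u_pow by (simp add: pow_eq_id)
        moreover have "ord u \<noteq> 1" using u pow_ord_eq_1[OF u(2)] by (metis nat_pow_eone)
        ultimately show ?thesis using p by (auto simp: prime_nat_iff)
      qed
      \<comment> \<open>A subgroup of \<open>H\<close> of order \<open>p\<close>, acting freely on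
        the values by left translation with constant fibre size along each orbit.\<close>
      define P where "P = generate G {u}"
      have P: "P = range (\<lambda>a::nat. u [^] a)"
        using generate_pow_nat[OF u(2)] ord_u p by (auto simp: P_def)
      have card_P: "card P = p" using generate_pow_card[OF u(2)] ord_u by (simp add: P_def)
      have sub_P: "subgroup P G" unfolding P_def using u by (intro generate_is_subgroup) auto
      have PH: "P \<subseteq> H" unfolding P_def by (rule generate_subgroup_incl[OF _ H(1)]) (use u in auto)
      show ?thesis
      proof (rule orbit_weighted_sum_dvd[OF sub_P, where \<phi> = "\<lambda>h x. h \<otimes> x"])
        show "finite P" using PH H(2) by (rule finite_subset)
        show "finite {x. x \<in> C \<and> x [^] p = t i}" using finS by (simp add: C_def)
        fix x assume "x \<in> {x. x \<in> C \<and> x [^] p = t i}"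
        then have x: "x \<in> C" "x \<in> S" "x \<in> carrier G" "x [^] p = t i" using S_carrier by (auto simp: C_def)
        have W_P: "card (W (h \<otimes> x)) = card (W x)" if h: "h \<in> P" for h
        proof -
          obtain a :: nat where "h = u [^] a" using h P by blast
          then show ?thesis using W_pow[OF x(3), of "p ^ l * a"] v by (simp add: u_def nat_pow_pow)
        qed
        show "\<one> \<otimes> x = x" using x by simp
        \<comment> \<open>The translate has a nonempty fibre, so it is a value and lies in
          \<open>C\<close>; its \<open>p\<close>-th power is unchanged since \<open>h\<close>
          commutes with \<open>x\<close> and has trivial \<open>p\<close>-th power.\<close>
        show "h \<otimes> x \<in> {x. x \<in> C \<and> x [^] p = t i}" if h: "h \<in> P" for h
        proof -
          have hH: "h \<in> H" using h PH by blast
          have "h \<otimes> x \<in> C" using C_eq[of "h \<otimes> x"] W_P[OF h] x hH by (simp add: S_iff)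
          moreover have "h [^] p = \<one>"
          proof -
            obtain a :: nat where "h = u [^] a" using h P by blast
            then show ?thesis using u u_pow by (metis mult.commute nat_pow_one nat_pow_pow)
          qed
          moreover have "h \<otimes> x = x \<otimes> h" using x(1) hH by (auto simp: C_def)
          ultimately show ?thesis using x hH t[OF i(1)] by (simp add: pow_mult_distrib)
        qed
        show "h \<otimes> (h' \<otimes> x) = h \<otimes> h' \<otimes> x" if "h \<in> P" "h' \<in> P" for h h'
          using that x(3) by (simp add: m_assoc subgroup.mem_carrier[OF sub_P])
        show "card (W (h \<otimes> x)) = card (W x)" if "h \<in> P" for h by (rule W_P[OF that])
        have "{h \<in> P. h \<otimes> x = x} = {\<one>}"
          using x(3) subgroup.one_closed[OF sub_P] subgroup.mem_carrier[OF sub_P] r_cancel_one'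
          by (auto dest!: sym[of _ x])
        \<comment> \<open>Here the centralizer of \<open>x\<close> is all of \<open>H\<close>; the
          orbit length \<open>p\<close> makes up for the exponent lowered by one.\<close>
        moreover have "d dvd card (W x) * p"
        proof -
          have "{h \<in> H. h \<otimes> x = x \<otimes> h} = H" using x(1) by (auto simp: C_def)
          then have "p * gcd (p ^ N) (card H) dvd p * card (W x)"
            using W_dvd[OF x(2)] by simp
          moreover have "d dvd p * gcd (p ^ N) (card H)"
            by (auto simp: d gcd_mult_distrib_nat)
          ultimately show ?thesis by (metis dvd_trans mult.commute)
        qed
        ultimately show "d * card {h \<in> P. h \<otimes> x = x} dvd card (W x) * card P"
          by (simp add: card_P)
      qed
    qed
  qed
  \<comment> \<open>The tuples in \<open>T\<close> split into those with noncentral and those with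
    central value; both parts are multiples of \<open>d\<close>.\<close>
  then have "d dvd card T"
    unfolding T_eq sum_W[of "\<lambda>x. x [^] p = t i"] split[of "\<lambda>x. x [^] p = t i"]
    using noncentral_P[of "\<lambda>x. x [^] p = t i"] pow_conj by (intro dvd_add) blast+
  then show ?case by (simp add: d_def T_def)
qed

end

section \<open>Bases of finite abelian p-groups\<close>

lemma (in group) subgroup_nat_pow_closed:
  assumes "subgroup H G" "x \<in> H"
  shows "x [^] (n::nat) \<in> H"
  using assms by (induction n) (simp_all add: subgroup.one_closed subgroup.m_closed)

lemma (in group) mem_generate_singleton:
  assumes "finite (carrier G)" "s \<in> carrier G"
  shows "x \<in> generate G {s} \<longleftrightarrow> (\<exists>a::nat. x = s [^] a)"
proof -
  have "ord s \<noteq> 0" using ord_ge_1[OF assms] by simp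
  then show ?thesis using generate_pow_nat[OF assms(2)] by auto
qed

context comm_group
begin

text \<open>An element \<open>s\<close> of maximal order in \<open>B\<close> generates a direct
  factor. The complement \<open>L\<close> is a subgroup of \<open>B\<close> maximal among those
  meeting the cyclic group trivially; if the product were smaller than \<open>B\<close>, some
  \<open>y\<close> outside it with \<open>y [^] p\<close> in \<open>L\<close> could be adjoined to
  \<open>L\<close>. Nontriviality of \<open>s\<close> makes \<open>L\<close> strictly smaller than
  \<open>B\<close>.\<close>

lemma cyclic_factor:
  assumes p: "Factorial_Ring.prime p" and ordG: "order G = p ^ N"
    and B: "subgroup B G" "B \<noteq> {\<one>}"
  shows "\<exists>s L. s \<in> B \<and> s \<noteq> \<one> \<and> subgroup L G \<and> generate G {s} \<inter> L = {\<one>} \<and> B = generate G {s} <#> L"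
proof -
  interpret B: subgroup B G by fact
  \<comment> \<open>An infinite carrier would have \<open>order\<close> 0, which is no power of
    \<open>p\<close>.\<close>
  have fin: "finite (carrier G)"
    using ordG p by (metis card.infinite order_def not_prime_0 power_not_zero)
  have finB: "finite B" using fin B.subset by (rule rev_finite_subset)
  have pow_ord: "\<exists>k. ord x = p ^ k" if "x \<in> carrier G" for x
    using ord_dvd_group_order[OF that] ordG p by (auto simp: divides_primepow_nat)
  obtain s where s: "s \<in> B" and max: "\<And>x. x \<in> B \<Longrightarrow> ord x \<le> ord s"
  proof -
    have "B \<noteq> {}" using B.one_closed by blast
    then have "Max (ord ` B) \<in> ord ` B" using finB by (intro Max_in) auto
    then obtain s where "s \<in> B" "ord s = Max (ord ` B)" by auto
    then show ?thesis using finB that[of s] by simp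
  qed
  have sc: "s \<in> carrier G" using s by simp
  obtain n where n: "ord s = p ^ n" using pow_ord[OF sc] by blast
  \<comment> \<open>Orders are powers of \<open>p\<close>, so being at most the maximal order means
    dividing it.\<close>
  have exponent: "x [^] (p ^ n) = \<one>" if x: "x \<in> B" for x
  proof -
    obtain k where k: "ord x = p ^ k" using pow_ord[OF B.mem_carrier[OF x]] by blast
    have "p ^ k \<le> p ^ n" using max[OF x] k n by simp
    then have "k \<le> n" by (rule power_le_imp_le_exp[OF prime_gt_1_nat[OF p]])
    then have "ord x dvd p ^ n" using k by (simp add: le_imp_power_dvd)
    then show ?thesis using x by (simp add: pow_eq_id)
  qed
  have s_ne: "s \<noteq> \<one>"
  proof
    assume "s = \<one>"
    then have "ord s = 1" using ord_eq_1 sc by blast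
    then have "ord x = 1" if "x \<in> B" for x
      using max[OF that] ord_ge_1[OF fin B.mem_carrier[OF that]] \<open>ord s = 1\<close> by linarith
    then have "x = \<one>" if "x \<in> B" for x using that ord_eq_1[OF B.mem_carrier[OF that]] by simp
    then show False using B(2) B.one_closed by blast
  qed
  \<comment> \<open>Needed for the exponent \<open>n - 1\<close> below.\<close>
  have n_pos: "n > 0"
  proof (rule ccontr)
    assume "\<not> n > 0"
    then have "ord s = 1" using n by simp
    then show False using s_ne sc ord_eq_1 by blast
  qed
  define Z where "Z = generate G {s}"
  have Z: "x \<in> Z \<longleftrightarrow> (\<exists>a::nat. x = s [^] a)" for x
    unfolding Z_def by (rule mem_generate_singleton[OF fin sc])
  have Z_sub: "subgroup Z G" unfolding Z_def using sc by (intro generate_is_subgroup) simp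
  interpret Z: subgroup Z G by (rule Z_sub)
  have ZB: "Z \<subseteq> B" unfolding Z_def by (rule generate_subgroup_incl[OF _ B(1)]) (use s in simp)
  define F where "F = {L. subgroup L G \<and> L \<subseteq> B \<and> Z \<inter> L = {\<one>}}"
  have "finite F" by (rule finite_subset[of _ "Pow B"]) (use finB in \<open>auto simp: F_def\<close>)
  moreover have "{\<one>} \<in> F" by (simp add: F_def triv_subgroup)
  ultimately obtain L where L: "L \<in> F" and L_max: "\<And>L'. \<lbrakk>L' \<in> F; L \<subseteq> L'\<rbrakk> \<Longrightarrow> L = L'"
    using finite_has_maximal[of F] by blast
  have LD: "subgroup L G" "L \<subseteq> B" "Z \<inter> L = {\<one>}" using L by (auto simp: F_def)
  interpret L: subgroup L G by (rule LD(1))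
  define D where "D = Z <#> L"
  have D_sub: "subgroup D G" unfolding D_def by (rule mult_subgroups[OF Z_sub LD(1)])
  interpret D: subgroup D G by (rule D_sub)
  have DI: "z \<otimes> l \<in> D" if "z \<in> Z" "l \<in> L" for z l
    using that by (auto simp: D_def set_mult_def)
  have ZD: "Z \<subseteq> D" using DI[OF _ L.one_closed] by auto
  have LD': "L \<subseteq> D" using DI[OF Z.one_closed] by auto
  have "D \<subseteq> B" using ZB LD(2) by (auto simp: D_def set_mult_def)
  moreover have "B \<subseteq> D"
  proof (rule ccontr)
    assume "\<not> B \<subseteq> D"
    then obtain x where x: "x \<in> B" "x \<notin> D" by blast
    define j where "j = (LEAST j. x [^] (p ^ j) \<in> D)"
    have j: "x [^] (p ^ j) \<in> D"
      unfolding j_def by (rule LeastI[of _ n]) (simp add: exponent[OF x(1)])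
    have "j \<noteq> 0"
    proof
      assume "j = 0"
      then show False using j x by simp
    qed
    then obtain j' where j': "j = Suc j'" using not0_implies_Suc by blast
    \<comment> \<open>The last iterated \<open>p\<close>-th power of \<open>x\<close> outside
      \<open>D\<close>; its own \<open>p\<close>-th power lies in \<open>D\<close>.\<close>
    define z where "z = x [^] (p ^ j')"
    have z: "z \<in> B" "z \<in> carrier G" using subgroup_nat_pow_closed[OF B(1) x(1)] by (simp_all add: z_def)
    have zD: "z \<notin> D"
      using not_less_Least[of j' "\<lambda>j. x [^] (p ^ j) \<in> D"] j' by (simp add: z_def j_def)
    have "z [^] p = x [^] (p ^ j)" using x(1) by (simp add: z_def j' nat_pow_pow mult.commute)
    then have "z [^] p \<in> D" using j by simp
    then obtain k :: nat and b where kb: "b \<in> L" "z [^] p = s [^] k \<otimes> b"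
      using Z by (auto simp: D_def set_mult_def)
    have bc: "b \<in> carrier G" using kb(1) by simp
    \<comment> \<open>Raising \<open>z [^] p\<close> to the power \<open>q\<close> kills it, so
      \<open>s [^] (k * q)\<close> lies in both factors and is trivial; the order
      \<open>p * q\<close> of \<open>s\<close> then divides \<open>k * q\<close>.\<close>
    have "p dvd k"
    proof -
      define q where "q = p ^ (n - 1)"
      have q: "p * q = p ^ n" using n_pos by (simp add: q_def flip: power_Suc)
      have "\<one> = (z [^] p) [^] q" using exponent[OF z(1)] z(2) by (simp add: nat_pow_pow q)
      also have "\<dots> = s [^] (k * q) \<otimes> b [^] q"
        using sc bc by (simp add: kb(2) nat_pow_distrib nat_pow_pow)
      finally have "s [^] (k * q) = inv (b [^] q)"
        using sc bc by (metis inv_equality nat_pow_closed)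
      moreover have "b [^] q \<in> L" by (rule subgroup_nat_pow_closed[OF LD(1) kb(1)])
      ultimately have "s [^] (k * q) \<in> L" by (simp only: L.m_inv_closed)
      moreover have "s [^] (k * q) \<in> Z" using Z by blast
      ultimately have "s [^] (k * q) = \<one>" using LD(3) by blast
      then have "p * q dvd k * q" using sc n q by (simp add: pow_eq_id)
      moreover have "q > 0" using p by (simp add: q_def prime_gt_0_nat)
      ultimately show ?thesis by simp
    qed
    then obtain k' where k': "k = p * k'" by blast
    \<comment> \<open>Correcting \<open>z\<close> by a power of \<open>s\<close> moves its
      \<open>p\<close>-th power into \<open>L\<close> without entering \<open>D\<close>.\<close>
    define y where "y = z \<otimes> inv (s [^] k')"
    have yc: "y \<in> carrier G" using z sc by (simp add: y_def)
    have yB: "y \<in> B" using z(1) subgroup_nat_pow_closed[OF B(1) s] by (simp add: y_def)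
    have z_eq: "z = y \<otimes> s [^] k'" using z sc by (simp add: y_def m_assoc)
    have "s [^] k' \<in> D" using Z ZD by blast
    then have "y \<notin> D" using zD D.m_closed[of y "s [^] k'"] by (auto simp flip: z_eq)
    have y_pow: "y [^] p = b"
    proof -
      have "z [^] p = y [^] p \<otimes> s [^] k"
        unfolding z_eq using yc sc by (simp add: nat_pow_distrib nat_pow_pow k' mult.commute)
      then have "s [^] k \<otimes> y [^] p = s [^] k \<otimes> b"
        unfolding kb(2) using yc sc by (simp add: m_comm)
      then show ?thesis using yc sc bc by simp
    qed
    define L' where "L' = generate G {y} <#> L"
    have y_sub: "subgroup (generate G {y}) G" using yc by (intro generate_is_subgroup) simp
    have L'_sub: "subgroup L' G" unfolding L'_def by (rule mult_subgroups[OF y_sub LD(1)])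
    have "Z \<inter> L' \<subseteq> {\<one>}"
    proof
      fix g assume g: "g \<in> Z \<inter> L'"
      then obtain e :: nat and l where l: "l \<in> L" "g = y [^] e \<otimes> l"
        using mem_generate_singleton[OF fin yc] by (auto simp: L'_def set_mult_def)
      have ye: "y [^] e \<in> D"
      proof -
        have "y [^] e = g \<otimes> inv l" using l yc by (simp add: m_assoc)
        then show ?thesis using g l(1) ZD LD' by auto
      qed
      have yp: "y [^] p \<in> D" using y_pow kb(1) LD' by auto
      \<comment> \<open>If \<open>e\<close> were prime to \<open>p\<close>, Bezout would express
        \<open>y\<close> through \<open>y [^] e\<close> and \<open>y [^] p\<close>, both in
        \<open>D\<close>.\<close>
      have "p dvd e"
      proof (rule ccontr)
        assume "\<not> p dvd e"
        then have "coprime p e" by (rule prime_imp_coprime[OF p])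
        moreover have "e \<noteq> 0" using \<open>\<not> p dvd e\<close> by (intro notI) simp
        ultimately obtain a c where "e * a = p * c + 1"
          using bezout_nat[of e p] by (auto simp: coprime_iff_gcd_eq_1 gcd.commute)
        then have "(y [^] e) [^] a = (y [^] p) [^] c \<otimes> y" using yc by (simp add: nat_pow_pow)
        then have "y = inv ((y [^] p) [^] c) \<otimes> (y [^] e) [^] a" using yc by simp
        also have "\<dots> \<in> D" using subgroup_nat_pow_closed[OF D_sub] ye yp by simp
        finally show False using \<open>y \<notin> D\<close> by blast
      qed
      then obtain f where "e = p * f" by blast
      then have "y [^] e = b [^] f" using y_pow yc by (simp flip: nat_pow_pow)
      then have "g \<in> L" using l subgroup_nat_pow_closed[OF LD(1) kb(1)] by simp
      then show "g \<in> {\<one>}" using g LD(3) by blast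
    qed
    moreover have "L' \<subseteq> B"
      using generate_subgroup_incl[of "{y}" B] yB B(1) LD(2) by (auto simp: L'_def set_mult_def)
    moreover have "\<one> \<in> L'" by (rule subgroup.one_closed[OF L'_sub])
    ultimately have "L' \<in> F" using L'_sub by (auto simp: F_def)
    have L'I: "g \<otimes> l \<in> L'" if "g \<in> generate G {y}" "l \<in> L" for g l
      using that by (auto simp: L'_def set_mult_def)
    have "l \<in> L'" if "l \<in> L" for l
      using L'I[OF generate.one that] that by simp
    then have "L = L'" using L_max[OF \<open>L' \<in> F\<close>] by blast
    moreover have "y \<in> L'"
      using L'I[OF generate.incl L.one_closed] yc by simp
    ultimately show False using LD' \<open>y \<notin> D\<close> by blast
  qed
  ultimately show ?thesis
    using s s_ne LD(1,3) unfolding D_def Z_def by blast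
qed

end

section \<open>Homomorphisms determined on generators, and the basis\<close>

lemma hom_eq_on_generate:
  assumes "group G" "group K" and I: "I \<subseteq> carrier G"
    and hom: "\<phi> \<in> hom (G\<lparr>carrier := generate G I\<rparr>) K" "\<psi> \<in> hom (G\<lparr>carrier := generate G I\<rparr>) K"
    and eq: "\<And>i. i \<in> I \<Longrightarrow> \<phi> i = \<psi> i" and x: "x \<in> generate G I"
  shows "\<phi> x = \<psi> x"
proof -
  interpret G: group G by fact
  let ?B = "G\<lparr>carrier := generate G I\<rparr>"
  have sub: "subgroup (generate G I) G" by (rule G.generate_is_subgroup[OF I])
  interpret B: group ?B by (rule G.subgroup_imp_group[OF sub])
  have ghom: "group_hom ?B K \<phi>" "group_hom ?B K \<psi>"
    using hom assms(2) B.group_axioms by (auto simp: group_hom_def group_hom_axioms_def)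
  from x show ?thesis
  proof (induction x)
    case one
    then show ?case using group_hom.hom_one[OF ghom(1)] group_hom.hom_one[OF ghom(2)] by simp
  next
    case (incl h)
    then show ?case by (rule eq)
  next
    case (inv h)
    then have h: "h \<in> generate G I" by (rule generate.incl)
    then have "inv\<^bsub>G\<^esub> h = inv\<^bsub>?B\<^esub> h" using G.m_inv_consistent[OF sub] by simp
    then show ?case
      using group_hom.hom_inv[OF ghom(1), of h] group_hom.hom_inv[OF ghom(2), of h] h eq[OF inv] by simp
  next
    case (eng h k)
    then show ?case using hom by (simp add: hom_def)
  qed
qed

text \<open>Conjugating \<open>\<phi>\<close> by \<open>g\<close> gives another homomorphism that
  agrees with \<open>\<phi>\<close> on the generators.\<close>

lemma (in group) commute_hom_generate:
  assumes "group K" and I: "I \<subseteq> carrier G"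
    and hom: "\<phi> \<in> hom (G\<lparr>carrier := generate G I\<rparr>) K"
    and g: "g \<in> carrier K" "\<And>i. i \<in> I \<Longrightarrow> g \<otimes>\<^bsub>K\<^esub> \<phi> i = \<phi> i \<otimes>\<^bsub>K\<^esub> g"
    and x: "x \<in> generate G I"
  shows "g \<otimes>\<^bsub>K\<^esub> \<phi> x = \<phi> x \<otimes>\<^bsub>K\<^esub> g"
proof -
  interpret K: group K by fact
  have closed: "\<phi> x \<in> carrier K" if "x \<in> generate G I" for x
    using hom that by (auto simp: hom_def)
  have "(\<lambda>x. conjugate K g (\<phi> x)) \<in> hom (G\<lparr>carrier := generate G I\<rparr>) K"
    using hom closed g(1) by (auto simp: hom_def K.conjugate_mult)
  then have "conjugate K g (\<phi> x) = \<phi> x"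
  proof (rule hom_eq_on_generate[OF is_group assms(1) I _ hom _ x])
    show "conjugate K g (\<phi> i) = \<phi> i" if "i \<in> I" for i
      using g that closed[OF generate.incl[OF that]] by (simp add: K.conjugate_eq_iff)
  qed
  then show ?thesis using g(1) closed[OF x] by (simp add: K.conjugate_eq_iff)
qed

text \<open>The basis is described by its universal property: commuting images whose orders divide
  those of the basis elements extend to a homomorphism. The target \<open>K\<close> need not be
  abelian, whence the commutation condition. Stating it for subgroups \<open>B\<close> allows
  induction on \<open>card B\<close>, splitting off one cyclic factor each time.\<close>

lemma (in comm_group) exists_basis:
  fixes K :: "('k, 'y) monoid_scheme"
  assumes p: "Factorial_Ring.prime p" and ordG: "order G = p ^ N" and K: "group K"
    and B: "subgroup B G"
  shows "\<exists>I \<subseteq> carrier G. finite I \<and> generate G I = B \<and> card B = (\<Prod>i\<in>I. ord i) \<and>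
    (\<forall>f \<in> I \<rightarrow> carrier K. (\<forall>i\<in>I. \<forall>j\<in>I. f i \<otimes>\<^bsub>K\<^esub> f j = f j \<otimes>\<^bsub>K\<^esub> f i) \<longrightarrow>
      (\<forall>i\<in>I. f i [^]\<^bsub>K\<^esub> ord i = \<one>\<^bsub>K\<^esub>) \<longrightarrow>
      (\<exists>\<phi> \<in> hom (G\<lparr>carrier := B\<rparr>) K. \<forall>i\<in>I. \<phi> i = f i))"
  using B
proof (induction "card B" arbitrary: B rule: less_induct)
  case less
  interpret K: group K by (rule K)
  interpret B: subgroup B G by (rule less.prems)
  have fin: "finite (carrier G)"
    using ordG p by (metis card.infinite order_def not_prime_0 power_not_zero)
  have finB: "finite B" using fin B.subset by (rule rev_finite_subset)
  show ?case
  proof (cases "B = {\<one>}")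
    case True
    have "(\<lambda>_. \<one>\<^bsub>K\<^esub>) \<in> hom (G\<lparr>carrier := B\<rparr>) K" by (simp add: hom_def)
    then show ?thesis using True generate_empty by (intro exI[of _ "{}"]) auto
  next
    case False
    obtain s L where s: "s \<in> B" "s \<noteq> \<one>" and L: "subgroup L G" "generate G {s} \<inter> L = {\<one>}"
      and B_eq: "B = generate G {s} <#> L"
      using cyclic_factor[OF p ordG less.prems False] by blast
    interpret L: subgroup L G by (rule L(1))
    have sc: "s \<in> carrier G" using s by simp
    have pow_in: "s [^] a \<in> generate G {s}" for a :: nat
      using mem_generate_singleton[OF fin sc] by blast
    have BI: "s [^] a \<otimes> b \<in> B" if "b \<in> L" for a :: nat and b
      using pow_in that by (auto simp: B_eq set_mult_def)
    have BE: "\<exists>(a::nat) b. b \<in> L \<and> x = s [^] a \<otimes> b" if "x \<in> B" for x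
    proof -
      obtain z b where "z \<in> generate G {s}" "b \<in> L" "x = z \<otimes> b"
        using \<open>x \<in> B\<close> by (auto simp: B_eq set_mult_def)
      moreover from this obtain a :: nat where "z = s [^] a"
        unfolding mem_generate_singleton[OF fin sc] by (elim exE)
      ultimately show ?thesis by (intro exI[of _ a] exI[of _ b]) simp
    qed
    have LB: "L \<subseteq> B" using BI[of _ 0] by auto
    have s_L: "s \<notin> L" using L(2) s(2) generate.incl[of s "{s}" G] by blast
    \<comment> \<open>Because the two factors meet trivially, both factors of an element are unique,
      though the exponent \<open>a\<close> is so only modulo \<open>ord s\<close>.\<close>
    have uniq: "s [^] a = s [^] a' \<and> b = b'"
      if b: "b \<in> L" "b' \<in> L" and eq: "s [^] a \<otimes> b = s [^] a' \<otimes> b'" for a a' :: nat and b b'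
    proof -
      have "inv (s [^] a') \<otimes> s [^] a = b' \<otimes> inv b"
      proof -
        have "inv (s [^] a') \<otimes> (s [^] a \<otimes> b) = b'" using eq b sc by simp
        then have "inv (s [^] a') \<otimes> s [^] a \<otimes> b = b'" using b sc by (simp add: m_assoc)
        then show ?thesis using b sc by (metis L.mem_carrier inv_closed m_closed mult_inv_eq_iff nat_pow_closed)
      qed
      moreover have "inv (s [^] a') \<otimes> s [^] a \<in> generate G {s}"
        using pow_in subgroup.m_closed[OF generate_is_subgroup] subgroup.m_inv_closed[OF generate_is_subgroup] sc
        by simp
      moreover have "b' \<otimes> inv b \<in> L" using b by simp
      ultimately have "b' \<otimes> inv b = \<one>" using L(2) by auto
      then have "b' = b" using b by (simp add: mult_inv_eq_iff)
      then show ?thesis using eq b sc by simp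
    qed
    have "card L < card B" using LB s(1) s_L finB by (metis psubsetI psubset_card_mono)
    from less.hyps[OF this L(1)] obtain J where J: "J \<subseteq> carrier G" "finite J" "generate G J = L"
      "card L = (\<Prod>i\<in>J. ord i)"
      and J_ext: "\<forall>f \<in> J \<rightarrow> carrier K. (\<forall>i\<in>J. \<forall>j\<in>J. f i \<otimes>\<^bsub>K\<^esub> f j = f j \<otimes>\<^bsub>K\<^esub> f i) \<longrightarrow>
        (\<forall>i\<in>J. f i [^]\<^bsub>K\<^esub> ord i = \<one>\<^bsub>K\<^esub>) \<longrightarrow>
        (\<exists>\<phi> \<in> hom (G\<lparr>carrier := L\<rparr>) K. \<forall>i\<in>J. \<phi> i = f i)"
      by (elim exE conjE)
    note J_hom = J_ext[THEN bspec, THEN mp, THEN mp]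
    have JL: "J \<subseteq> L" unfolding J(3)[symmetric] by (rule subsetI) (rule generate.incl)
    then have s_J: "s \<notin> J" using s_L by blast
    define I where "I = insert s J"
    have I: "I \<subseteq> carrier G" using J(1) sc by (simp add: I_def)
    have gen: "generate G I = B"
    proof
      show "generate G I \<subseteq> B"
        using JL LB s(1) by (intro generate_subgroup_incl[OF _ less.prems]) (auto simp: I_def)
      have sub: "subgroup (generate G I) G" by (rule generate_is_subgroup[OF I])
      have L_gen: "L \<subseteq> generate G I"
        using mono_generate[of J I] by (simp add: I_def J(3) subset_insertI)
      have s_gen: "s \<in> generate G I" by (rule generate.incl) (simp add: I_def)
      show "B \<subseteq> generate G I"
      proof
        fix x assume "x \<in> B"
        then obtain a :: nat and b where x: "b \<in> L" "x = s [^] a \<otimes> b" using BE by metis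
        then show "x \<in> generate G I"
          using subgroup.m_closed[OF sub subgroup_nat_pow_closed[OF sub s_gen]] L_gen by (simp add: subsetD)
      qed
    qed
    have "bij_betw (\<lambda>(z, b). z \<otimes> b) (generate G {s} \<times> L) B"
    proof -
      have "inj_on (\<lambda>(z, b). z \<otimes> b) (generate G {s} \<times> L)"
      proof (rule inj_onI, clarify)
        fix z z' b b' assume z: "z \<in> generate G {s}" "z' \<in> generate G {s}"
          and b: "b \<in> L" "b' \<in> L" and eq: "z \<otimes> b = z' \<otimes> b'"
        obtain a a' :: nat where "z = s [^] a" "z' = s [^] a'"
          using z unfolding mem_generate_singleton[OF fin sc] by (elim exE)
        then show "z = z' \<and> b = b'" using uniq[OF b] eq by simp
      qed
      moreover have "(\<lambda>(z, b). z \<otimes> b) ` (generate G {s} \<times> L) = B"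
        by (force simp: B_eq set_mult_def)
      ultimately show ?thesis by (simp add: bij_betw_def)
    qed
    then have "card B = card (generate G {s}) * card L"
      by (metis bij_betw_same_card card_cartesian_product)
    then have card_B: "card B = (\<Prod>i\<in>I. ord i)"
      using J(2,4) s_J generate_pow_card[OF sc] by (simp add: I_def)
    have "\<exists>\<phi> \<in> hom (G\<lparr>carrier := B\<rparr>) K. \<forall>i\<in>I. \<phi> i = f i"
      if f: "f \<in> I \<rightarrow> carrier K" and comm: "\<forall>i\<in>I. \<forall>j\<in>I. f i \<otimes>\<^bsub>K\<^esub> f j = f j \<otimes>\<^bsub>K\<^esub> f i"
        and f_ord: "\<forall>i\<in>I. f i [^]\<^bsub>K\<^esub> ord i = \<one>\<^bsub>K\<^esub>" for f
    proof -
      have "\<exists>\<psi> \<in> hom (G\<lparr>carrier := L\<rparr>) K. \<forall>i\<in>J. \<psi> i = f i"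
        by (rule J_hom) (use f comm f_ord in \<open>auto simp: I_def\<close>)
      then obtain \<psi> where \<psi>: "\<psi> \<in> hom (G\<lparr>carrier := L\<rparr>) K" "\<And>i. i \<in> J \<Longrightarrow> \<psi> i = f i" by blast
      have \<psi>c: "\<psi> b \<in> carrier K" if "b \<in> L" for b using \<psi>(1) that by (auto simp: hom_def)
      have fs: "f s \<in> carrier K" "f s [^]\<^bsub>K\<^esub> ord s = \<one>\<^bsub>K\<^esub>" using f f_ord by (auto simp: I_def)
      have fs_comm: "f s \<otimes>\<^bsub>K\<^esub> \<psi> b = \<psi> b \<otimes>\<^bsub>K\<^esub> f s" if "b \<in> L" for b
      proof (rule commute_hom_generate[OF K J(1) _ fs(1)])
        show "\<psi> \<in> hom (G\<lparr>carrier := generate G J\<rparr>) K" using \<psi>(1) J(3) by simp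
        show "f s \<otimes>\<^bsub>K\<^esub> \<psi> i = \<psi> i \<otimes>\<^bsub>K\<^esub> f s" if i: "i \<in> J" for i
        proof -
          have "f s \<otimes>\<^bsub>K\<^esub> f i = f i \<otimes>\<^bsub>K\<^esub> f s"
            by (rule comm[rule_format]) (use i in \<open>simp_all add: I_def\<close>)
          then show ?thesis using \<psi>(2)[OF i] by simp
        qed
        show "b \<in> generate G J" using \<open>b \<in> L\<close> J(3) by simp
      qed
      \<comment> \<open>The order of \<open>f s\<close> divides that of \<open>s\<close>, so the
        ambiguity of the exponent does no harm.\<close>
      have f_pow: "f s [^]\<^bsub>K\<^esub> a = f s [^]\<^bsub>K\<^esub> a'" if "s [^] a = s [^] a'" for a a' :: nat
      proof -
        have "s [^] int a = s [^] int a'" using that by (simp add: int_pow_int)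
        then have "int (ord s) dvd int a' - int a" using int_pow_eq[OF sc] by blast
        moreover have "int (K.ord (f s)) dvd int (ord s)" using fs by (simp add: K.pow_eq_id)
        ultimately have "int (K.ord (f s)) dvd int a' - int a" by (metis dvd_trans)
        then have "f s [^]\<^bsub>K\<^esub> int a = f s [^]\<^bsub>K\<^esub> int a'" using K.int_pow_eq[OF fs(1)] by blast
        then show ?thesis by (simp add: int_pow_int)
      qed
      \<comment> \<open>An arbitrary factorization of \<open>x\<close>; by \<open>uniq\<close> and
        \<open>f_pow\<close> the value of \<open>\<phi>\<close> does not depend on the
        choice.\<close>
      define dec where "dec x = (SOME (a::nat, b). b \<in> L \<and> x = s [^] a \<otimes> b)" for x
      define \<phi> where "\<phi> x = (case dec x of (a, b) \<Rightarrow> f s [^]\<^bsub>K\<^esub> a \<otimes>\<^bsub>K\<^esub> \<psi> b)" for x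
      have \<phi>: "\<phi> (s [^] a \<otimes> b) = f s [^]\<^bsub>K\<^esub> a \<otimes>\<^bsub>K\<^esub> \<psi> b" if b: "b \<in> L" for a :: nat and b
      proof -
        obtain a' b' where d: "dec (s [^] a \<otimes> b) = (a', b')" by (rule prod.exhaust)
        have "case dec (s [^] a \<otimes> b) of (a', b') \<Rightarrow> b' \<in> L \<and> s [^] a \<otimes> b = s [^] a' \<otimes> b'"
          unfolding dec_def by (rule someI[of _ "(a, b)"]) (use b in simp)
        then have d': "b' \<in> L" "s [^] a \<otimes> b = s [^] a' \<otimes> b'" by (simp_all add: d)
        have "s [^] a = s [^] a'" "b = b'" using uniq[OF b d'] by simp_all
        then show ?thesis using f_pow[of a a'] unfolding \<phi>_def d by simp
      qed
      have "\<phi> \<in> hom (G\<lparr>carrier := B\<rparr>) K"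
      proof (rule homI)
        fix x assume "x \<in> carrier (G\<lparr>carrier := B\<rparr>)"
        then show "\<phi> x \<in> carrier K" using BE[of x] \<phi> \<psi>c fs(1) by auto
      next
        fix x y assume "x \<in> carrier (G\<lparr>carrier := B\<rparr>)" "y \<in> carrier (G\<lparr>carrier := B\<rparr>)"
        then obtain a b a' b' where x: "b \<in> L" "x = s [^] (a::nat) \<otimes> b" and y: "b' \<in> L" "y = s [^] (a'::nat) \<otimes> b'"
          using BE[of x] BE[of y] by auto
        have "x \<otimes> y = s [^] (a + a') \<otimes> (b \<otimes> b')"
          using x y sc by (simp add: m_ac flip: nat_pow_mult)
        then have "\<phi> (x \<otimes> y) = f s [^]\<^bsub>K\<^esub> (a + a') \<otimes>\<^bsub>K\<^esub> \<psi> (b \<otimes> b')"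
          using x y \<phi> by simp
        also have "\<psi> (b \<otimes> b') = \<psi> b \<otimes>\<^bsub>K\<^esub> \<psi> b'" using \<psi>(1) x y by (simp add: hom_def)
        \<comment> \<open>Regroup so that the power of \<open>f s\<close> from the second factor can
          be exchanged with the image of \<open>b\<close>.\<close>
        also have "f s [^]\<^bsub>K\<^esub> (a + a') \<otimes>\<^bsub>K\<^esub> (\<psi> b \<otimes>\<^bsub>K\<^esub> \<psi> b')
            = f s [^]\<^bsub>K\<^esub> a \<otimes>\<^bsub>K\<^esub> (f s [^]\<^bsub>K\<^esub> a' \<otimes>\<^bsub>K\<^esub> \<psi> b) \<otimes>\<^bsub>K\<^esub> \<psi> b'"
          using fs(1) \<psi>c[OF x(1)] \<psi>c[OF y(1)] by (simp add: K.m_assoc flip: K.nat_pow_mult)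
        also have "f s [^]\<^bsub>K\<^esub> a' \<otimes>\<^bsub>K\<^esub> \<psi> b = \<psi> b \<otimes>\<^bsub>K\<^esub> f s [^]\<^bsub>K\<^esub> a'"
          using K.commute_pow[of "\<psi> b" "f s" a'] fs_comm[OF x(1)] fs(1) \<psi>c[OF x(1)] by simp
        also have "f s [^]\<^bsub>K\<^esub> a \<otimes>\<^bsub>K\<^esub> (\<psi> b \<otimes>\<^bsub>K\<^esub> f s [^]\<^bsub>K\<^esub> a') \<otimes>\<^bsub>K\<^esub> \<psi> b' = \<phi> x \<otimes>\<^bsub>K\<^esub> \<phi> y"
          using fs(1) \<psi>c[OF x(1)] \<psi>c[OF y(1)] \<phi>[OF x(1), of a] \<phi>[OF y(1), of a'] by (simp add: K.m_assoc x(2) y(2))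
        finally show "\<phi> (x \<otimes>\<^bsub>G\<lparr>carrier := B\<rparr>\<^esub> y) = \<phi> x \<otimes>\<^bsub>K\<^esub> \<phi> y" by simp
      qed
      moreover have "\<phi> i = f i" if "i \<in> I" for i
      proof (cases "i = s")
        case True
        have "\<psi> \<one> = \<one>\<^bsub>K\<^esub>"
          using hom_one[OF \<psi>(1)] subgroup_imp_group[OF L(1)] K by simp
        then show ?thesis using \<phi>[OF L.one_closed, of 1] True sc fs(1) by simp
      next
        case False
        then have i: "i \<in> J" using that by (simp add: I_def)
        then show ?thesis using \<phi>[of i 0] JL J(1) \<psi>(2)[OF i] \<psi>c[of i] by auto
      qed
      ultimately show ?thesis by blast
    qed
    note ext = this
    have "finite I" using J(2) by (simp add: I_def)
    then show ?thesis
      using I gen card_B by - (rule exI[of _ I], intro conjI ballI impI, assumption+, rule ext)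
  qed
qed

section \<open>Crossed homomorphisms as commuting tuples\<close>

text \<open>The \<open>M\<close>-component comes first and acts from the right on the earlier
  \<open>H\<close>-component, matching the law of crossed homomorphisms: these are the sections of
  the projection \<open>fst\<close>.\<close>

definition semidirect_product ::
    "('m, 'x) monoid_scheme \<Rightarrow> ('h, 'y) monoid_scheme \<Rightarrow> ('h \<Rightarrow> 'm \<Rightarrow> 'h) \<Rightarrow> ('m \<times> 'h) monoid"
  where "semidirect_product M H act =
    \<lparr>carrier = carrier M \<times> carrier H,
     Group.monoid.mult = (\<lambda>(a, h) (b, k). (a \<otimes>\<^bsub>M\<^esub> b, act h b \<otimes>\<^bsub>H\<^esub> k)),
     Group.monoid.one = (\<one>\<^bsub>M\<^esub>, \<one>\<^bsub>H\<^esub>)\<rparr>"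

context right_group_action
begin

lemma act_closed [simp]: "\<lbrakk>a \<in> carrier M; h \<in> carrier H\<rbrakk> \<Longrightarrow> act h a \<in> carrier H"
  using act_automorphism[of a] by (auto simp: iso_def hom_def)

lemma act_H_mult:
  "\<lbrakk>a \<in> carrier M; h \<in> carrier H; k \<in> carrier H\<rbrakk> \<Longrightarrow> act (h \<otimes>\<^bsub>H\<^esub> k) a = act h a \<otimes>\<^bsub>H\<^esub> act k a"
  using act_automorphism[of a] by (auto simp: iso_def hom_def)

lemma act_H_one [simp]:
  assumes "a \<in> carrier M"
  shows "act \<one>\<^bsub>H\<^esub> a = \<one>\<^bsub>H\<^esub>"
proof -
  have "(\<lambda>h. act h a) \<in> hom H H" using act_automorphism[OF assms] by (simp add: iso_def)
  from hom_one[OF this] show ?thesis using H.group_axioms by simp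
qed

abbreviation "SP \<equiv> semidirect_product M H act"

lemma SP_simps [simp]:
  "carrier SP = carrier M \<times> carrier H"
  "(a, h) \<otimes>\<^bsub>SP\<^esub> (b, k) = (a \<otimes>\<^bsub>M\<^esub> b, act h b \<otimes>\<^bsub>H\<^esub> k)"
  "\<one>\<^bsub>SP\<^esub> = (\<one>\<^bsub>M\<^esub>, \<one>\<^bsub>H\<^esub>)"
  by (simp_all add: semidirect_product_def)

lemma group_SP: "group SP"
proof (rule groupI)
  fix x y z assume "x \<in> carrier SP" "y \<in> carrier SP" "z \<in> carrier SP"
  then show "x \<otimes>\<^bsub>SP\<^esub> y \<otimes>\<^bsub>SP\<^esub> z = x \<otimes>\<^bsub>SP\<^esub> (y \<otimes>\<^bsub>SP\<^esub> z)"
    by (cases x; cases y; cases z) (simp add: M.m_assoc H.m_assoc act_H_mult act_mult)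
next
  fix x assume x: "x \<in> carrier SP"
  obtain a h where ah: "x = (a, h)" "a \<in> carrier M" "h \<in> carrier H" using x by (cases x) auto
  \<comment> \<open>This makes \<open>inv h\<close> moved by \<open>inv a\<close> the second
    component of a left inverse of the pair \<open>(a, h)\<close>.\<close>
  have "act (act (inv\<^bsub>H\<^esub> h) (inv\<^bsub>M\<^esub> a)) a = inv\<^bsub>H\<^esub> h"
    using ah act_mult[of "inv\<^bsub>H\<^esub> h" "inv\<^bsub>M\<^esub> a" a] by (simp add: act_one)
  then show "\<exists>y\<in>carrier SP. y \<otimes>\<^bsub>SP\<^esub> x = \<one>\<^bsub>SP\<^esub>"
    using ah by (intro bexI[of _ "(inv\<^bsub>M\<^esub> a, act (inv\<^bsub>H\<^esub> h) (inv\<^bsub>M\<^esub> a))"]) simp_all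
qed (auto simp: act_one)

lemma fst_hom: "fst \<in> hom SP M"
  by (rule homI) auto

lemma inclusion_hom: "Pair \<one>\<^bsub>M\<^esub> \<in> hom H SP"
  by (rule homI) (auto simp: act_one)

lemma crossed_hom_iff_hom:
  assumes "\<alpha> \<in> carrier M \<rightarrow> carrier H"
  shows "(\<lambda>a. (a, \<alpha> a)) \<in> hom M SP \<longleftrightarrow>
    (\<forall>a\<in>carrier M. \<forall>b\<in>carrier M. \<alpha> (a \<otimes>\<^bsub>M\<^esub> b) = act (\<alpha> a) b \<otimes>\<^bsub>H\<^esub> \<alpha> b)"
  using assms by (auto simp: hom_def)

text \<open>A section is determined by its values on the basis, which commute, satisfy the order
  relations and lie over the basis elements. Conversely, such values extend to a homomorphism by
  \<open>ext\<close>, and its first component is the identity on the generators, hence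
  everywhere.\<close>

lemma card_crossed_homs_eq_commuting_tuples:
  assumes I: "I \<subseteq> carrier M" "generate M I = carrier M"
    and ext: "\<And>f. \<lbrakk>f \<in> I \<rightarrow> carrier SP; \<forall>i\<in>I. \<forall>j\<in>I. f i \<otimes>\<^bsub>SP\<^esub> f j = f j \<otimes>\<^bsub>SP\<^esub> f i;
      \<forall>i\<in>I. f i [^]\<^bsub>SP\<^esub> M.ord i = \<one>\<^bsub>SP\<^esub>\<rbrakk> \<Longrightarrow> \<exists>\<phi> \<in> hom M SP. \<forall>i\<in>I. \<phi> i = f i"
    and comm: "\<And>a b. \<lbrakk>a \<in> carrier M; b \<in> carrier M\<rbrakk> \<Longrightarrow> a \<otimes>\<^bsub>M\<^esub> b = b \<otimes>\<^bsub>M\<^esub> a"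
  shows "card (crossed_homs M H act) =
    card (commuting_tuples SP ({\<one>\<^bsub>M\<^esub>} \<times> carrier H) I (\<lambda>i. (i, \<one>\<^bsub>H\<^esub>)) I M.ord (\<lambda>_. \<one>\<^bsub>SP\<^esub>))"
    (is "_ = card ?W")
proof -
  interpret SP: group SP by (rule group_SP)
  have fst_SP: "group_hom SP M fst"
    using fst_hom SP.group_axioms M.group_axioms by (simp add: group_hom_def group_hom_axioms_def)
  \<comment> \<open>Lying in the coset of \<open>(a, 1)\<close> modulo the copy of \<open>H\<close>
    means having first component \<open>a\<close>, since that copy is the kernel of
    \<open>fst\<close>.\<close>
  have coset: "x \<otimes>\<^bsub>SP\<^esub> inv\<^bsub>SP\<^esub> (a, \<one>\<^bsub>H\<^esub>) \<in> {\<one>\<^bsub>M\<^esub>} \<times> carrier H \<longleftrightarrow> fst x = a"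
    if x: "x \<in> carrier SP" and a: "a \<in> carrier M" for x a
  proof -
    define y where "y = x \<otimes>\<^bsub>SP\<^esub> inv\<^bsub>SP\<^esub> (a, \<one>\<^bsub>H\<^esub>)"
    have aSP: "(a, \<one>\<^bsub>H\<^esub>) \<in> carrier SP" using a by simp
    have y: "y \<in> carrier SP" unfolding y_def using x aSP by (intro SP.m_closed SP.inv_closed)
    have "fst y = fst x \<otimes>\<^bsub>M\<^esub> inv\<^bsub>M\<^esub> a"
      unfolding y_def using group_hom.hom_mult[OF fst_SP x SP.inv_closed[OF aSP]]
        group_hom.hom_inv[OF fst_SP aSP] by simp
    then have "fst y = \<one>\<^bsub>M\<^esub> \<longleftrightarrow> fst x = a"
      using x a by (cases x) (auto simp: M.mult_inv_eq_iff)
    then show ?thesis using y unfolding y_def[symmetric] by (cases y) auto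
  qed
  define graph where "graph \<alpha> = (\<lambda>i\<in>I. (i, \<alpha> i))" for \<alpha> :: "'m \<Rightarrow> 'h"
  have CH: "\<alpha> \<in> carrier M \<rightarrow>\<^sub>E carrier H" "(\<lambda>a. (a, \<alpha> a)) \<in> hom M SP"
    if "\<alpha> \<in> crossed_homs M H act" for \<alpha>
    using that crossed_hom_iff_hom[of \<alpha>] by (auto simp: crossed_homs_def)
  have "bij_betw graph (crossed_homs M H act) ?W"
  proof (rule bij_betw_imageI)
    show "inj_on graph (crossed_homs M H act)"
    proof (rule inj_onI)
      fix \<alpha> \<beta> assume \<alpha>: "\<alpha> \<in> crossed_homs M H act" and \<beta>: "\<beta> \<in> crossed_homs M H act"
        and eq: "graph \<alpha> = graph \<beta>"
      show "\<alpha> = \<beta>"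
      proof (rule PiE_ext[OF CH(1)[OF \<alpha>] CH(1)[OF \<beta>]])
        fix a assume a: "a \<in> carrier M"
        have "(a, \<alpha> a) = (a, \<beta> a)"
        proof (rule hom_eq_on_generate[OF M.group_axioms SP.group_axioms I(1), where \<phi> = "\<lambda>a. (a, \<alpha> a)"])
          show "(i, \<alpha> i) = (i, \<beta> i)" if "i \<in> I" for i
            using fun_cong[OF eq, of i] that by (simp add: graph_def)
        qed (use CH(2)[OF \<alpha>] CH(2)[OF \<beta>] a in \<open>simp_all add: I(2)\<close>)
        then show "\<alpha> a = \<beta> a" by simp
      qed
    qed
    show "graph ` crossed_homs M H act = ?W"
    proof (intro equalityI subsetI)
      fix g assume "g \<in> graph ` crossed_homs M H act"
      then obtain \<alpha> where \<alpha>: "\<alpha> \<in> crossed_homs M H act" and g: "g = graph \<alpha>" by blast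
      have gi: "g i = (i, \<alpha> i)" if "i \<in> I" for i using that by (simp add: g graph_def)
      have IM: "i \<in> carrier M" if "i \<in> I" for i using that I(1) by blast
      note hom = CH(2)[OF \<alpha>]
      have closed: "(a, \<alpha> a) \<in> carrier SP" if "a \<in> carrier M" for a
        using hom that by (auto simp: hom_def)
      have mult: "(a, \<alpha> a) \<otimes>\<^bsub>SP\<^esub> (b, \<alpha> b) = (a \<otimes>\<^bsub>M\<^esub> b, \<alpha> (a \<otimes>\<^bsub>M\<^esub> b))"
        if "a \<in> carrier M" "b \<in> carrier M" for a b
        using hom_mult[OF hom that] by (simp only:)
      show "g \<in> ?W"
      proof (rule SP.commuting_tuplesI)
        show "g \<in> extensional I" by (simp add: g graph_def)
        show "g i \<in> carrier SP" if "i \<in> I" for i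
          using closed[OF IM[OF that]] gi[OF that] by (simp only:)
        show "g i \<otimes>\<^bsub>SP\<^esub> inv\<^bsub>SP\<^esub> (i, \<one>\<^bsub>H\<^esub>) \<in> {\<one>\<^bsub>M\<^esub>} \<times> carrier H" if "i \<in> I" for i
          unfolding gi[OF that] coset[OF closed[OF IM[OF that]] IM[OF that]] by simp
        show "g i \<otimes>\<^bsub>SP\<^esub> g j = g j \<otimes>\<^bsub>SP\<^esub> g i" if "i \<in> I" "j \<in> I" for i j
          unfolding gi[OF that(1)] gi[OF that(2)] mult[OF IM[OF that(1)] IM[OF that(2)]]
            mult[OF IM[OF that(2)] IM[OF that(1)]]
          by (simp only: comm[OF IM[OF that(1)] IM[OF that(2)]])
        show "g i [^]\<^bsub>SP\<^esub> M.ord i = \<one>\<^bsub>SP\<^esub>" if i: "i \<in> I" for i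
        proof -
          have "(i, \<alpha> i) [^]\<^bsub>SP\<^esub> M.ord i
              = (i [^]\<^bsub>M\<^esub> M.ord i, \<alpha> (i [^]\<^bsub>M\<^esub> M.ord i))"
            using hom_nat_pow[OF hom IM[OF i] M.group_axioms SP.group_axioms, of "M.ord i"] by (simp only:)
          also have "\<dots> = \<one>\<^bsub>SP\<^esub>"
            using hom_one[OF hom M.group_axioms SP.group_axioms] M.pow_ord_eq_1[OF IM[OF i]] by (simp only:)
          finally show ?thesis by (simp only: gi[OF i])
        qed
      qed
    next
      fix g assume g: "g \<in> ?W"
      note D = SP.commuting_tuplesD[OF g]
      have "\<exists>\<phi> \<in> hom M SP. \<forall>i\<in>I. \<phi> i = g i"
        by (rule ext) (use D in blast)+
      then obtain \<phi> where \<phi>: "\<phi> \<in> hom M SP" "\<And>i. i \<in> I \<Longrightarrow> \<phi> i = g i" by blast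
      have \<phi>_closed: "\<phi> a \<in> carrier M \<times> carrier H" if "a \<in> carrier M" for a
        using \<phi>(1) that by (auto simp: hom_def)
      have fst_\<phi>: "fst (\<phi> a) = a" if a: "a \<in> carrier M" for a
      proof (rule hom_eq_on_generate[OF M.group_axioms M.group_axioms I(1),
            where \<phi> = "\<lambda>a. fst (\<phi> a)" and \<psi> = "\<lambda>a. a"])
        show "(\<lambda>a. fst (\<phi> a)) \<in> hom (M\<lparr>carrier := generate M I\<rparr>) M"
          using hom_compose[OF \<phi>(1) fst_hom] by (simp add: I(2) comp_def)
        show "(\<lambda>a. a) \<in> hom (M\<lparr>carrier := generate M I\<rparr>) M" by (simp add: I(2) hom_def)
        show "fst (\<phi> i) = i" if i: "i \<in> I" for i
          using coset[OF D(2)[OF i], of i] D(3)[OF i] I(1) i \<phi>(2)[OF i] by auto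
        show "a \<in> generate M I" using a by (simp add: I(2))
      qed
      \<comment> \<open>Restriction makes the second component extensional, as
        \<open>crossed_homs\<close> demands.\<close>
      define \<alpha> where "\<alpha> = (\<lambda>a\<in>carrier M. snd (\<phi> a))"
      have \<phi>_eq: "\<phi> a = (a, \<alpha> a)" if "a \<in> carrier M" for a
        using fst_\<phi>[OF that] that by (simp add: \<alpha>_def prod_eq_iff)
      have \<alpha>_PiE: "\<alpha> \<in> carrier M \<rightarrow>\<^sub>E carrier H"
        using \<phi>_closed by (auto simp: \<alpha>_def mem_Times_iff)
      have "(\<lambda>a. (a, \<alpha> a)) \<in> hom M SP"
      proof (rule homI)
        show "(a, \<alpha> a) \<in> carrier SP" if "a \<in> carrier M" for a
          using \<alpha>_PiE that by auto
        show "(a \<otimes>\<^bsub>M\<^esub> b, \<alpha> (a \<otimes>\<^bsub>M\<^esub> b)) = (a, \<alpha> a) \<otimes>\<^bsub>SP\<^esub> (b, \<alpha> b)"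
          if "a \<in> carrier M" "b \<in> carrier M" for a b
          using hom_mult[OF \<phi>(1) that] by (simp only: \<phi>_eq that M.m_closed)
      qed
      then have "\<alpha> \<in> crossed_homs M H act"
        using \<alpha>_PiE crossed_hom_iff_hom[of \<alpha>] by (auto simp: crossed_homs_def)
      moreover have "g = graph \<alpha>"
      proof (rule PiE_ext[OF D(1)])
        show "graph \<alpha> \<in> I \<rightarrow>\<^sub>E carrier SP"
          using \<alpha>_PiE I(1) by (auto simp: graph_def)
        show "g i = graph \<alpha> i" if "i \<in> I" for i
          using \<phi>(2)[OF that] \<phi>_eq[of i] I(1) that by (auto simp: graph_def)
      qed
      ultimately show "g \<in> graph ` crossed_homs M H act" by blast
    qed
  qed
  then show ?thesis by (rule bij_betw_same_card)
qed

end

section \<open>Divisibility of the number of crossed homomorphisms\<close>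

theorem theorem4p8:
  fixes p :: nat
    and H :: "('h, 'y) monoid_scheme"
    and M :: "('m, 'x) monoid_scheme"
    and act :: "'h \<Rightarrow> 'm \<Rightarrow> 'h"
  assumes "Factorial_Ring.prime p"
    and "finite_p_group p H"
    and "\<And>K. \<lbrakk>subgroup K H; \<not> comm_group (H\<lparr>carrier := K\<rparr>)\<rbrakk>
      \<Longrightarrow> elementary_abelian p (H\<lparr>carrier := group_center (H\<lparr>carrier := K\<rparr>)\<rparr>)"
    and "finite_p_group p M"
    and "comm_group M"
    and "right_group_action M H act"
  shows "gcd (order H) (order M) dvd card (crossed_homs M H act)"
proof -
  interpret right_group_action M H act by fact
  interpret M: comm_group M by fact
  interpret SP: group SP by (rule group_SP)
  obtain k where H: "finite (carrier H)" "order H = p ^ k"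
    using assms(2) by (auto simp: finite_p_group_def)
  obtain N where M: "order M = p ^ N" using assms(4) by (auto simp: finite_p_group_def)
  have "subgroup (carrier M) M" by (rule M.subgroup_self)
  from M.exists_basis[OF assms(1) M SP.group_axioms this] obtain I where
    I: "I \<subseteq> carrier M" "finite I" "generate M I = carrier M" "card (carrier M) = (\<Prod>i\<in>I. M.ord i)"
    and ext: "\<forall>f \<in> I \<rightarrow> carrier SP. (\<forall>i\<in>I. \<forall>j\<in>I. f i \<otimes>\<^bsub>SP\<^esub> f j = f j \<otimes>\<^bsub>SP\<^esub> f i) \<longrightarrow>
      (\<forall>i\<in>I. f i [^]\<^bsub>SP\<^esub> M.ord i = \<one>\<^bsub>SP\<^esub>) \<longrightarrow>
      (\<exists>\<phi> \<in> hom (M\<lparr>carrier := carrier M\<rparr>) SP. \<forall>i\<in>I. \<phi> i = f i)"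
    by (elim exE conjE)
  have M_upd: "M\<lparr>carrier := carrier M\<rparr> = M" by simp
  \<comment> \<open>The orders of the basis elements are powers of \<open>p\<close> whose exponents
    add up to that of \<open>order M\<close>; they become the \<open>n i\<close> of the counting
    lemma.\<close>
  have "\<forall>i\<in>I. \<exists>n. M.ord i = p ^ n"
  proof
    fix i assume "i \<in> I"
    then have "M.ord i dvd p ^ N" using M.ord_dvd_group_order I(1) M by (metis subsetD)
    then show "\<exists>n. M.ord i = p ^ n" using assms(1) by (auto simp: divides_primepow_nat)
  qed
  then obtain n where n: "\<And>i. i \<in> I \<Longrightarrow> M.ord i = p ^ n i" by metis
  have order_M: "order M = p ^ sum n I"
    using I(4) n by (simp add: order_def power_sum)
  define H' where "H' = {\<one>\<^bsub>M\<^esub>} \<times> carrier H"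
  have incl: "group_hom H SP (Pair \<one>\<^bsub>M\<^esub>)"
    using inclusion_hom SP.group_axioms H.group_axioms by (simp add: group_hom_def group_hom_axioms_def)
  have fst_SP: "group_hom SP M fst"
    using fst_hom SP.group_axioms M.group_axioms by (simp add: group_hom_def group_hom_axioms_def)
  have H'_img: "H' = Pair \<one>\<^bsub>M\<^esub> ` carrier H" by (auto simp: H'_def)
  have H'_sub: "subgroup H' SP"
    unfolding H'_img by (rule group_hom.img_is_subgroup[OF incl])
  have H'_fin: "finite H'" using H(1) by (simp add: H'_def)
  have card_H': "card H' = p ^ k" using H by (simp add: H'_def card_cartesian_product order_def)
  have H'_iff: "x \<in> H' \<longleftrightarrow> x \<in> carrier SP \<and> fst x = \<one>\<^bsub>M\<^esub>" for x
    by (cases x) (auto simp: H'_def)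
  have "gcd (p ^ sum n I) (card H')
    dvd card (commuting_tuples SP H' I (\<lambda>i. (i, \<one>\<^bsub>H\<^esub>)) I (\<lambda>i. p ^ n i) (\<lambda>_. \<one>\<^bsub>SP\<^esub>))"
  proof (rule SP.card_commuting_tuples_dvd[OF assms(1) I(2) H'_sub H'_fin card_H'])
    fix K assume K: "subgroup K SP" "K \<subseteq> H'" "\<exists>x\<in>K. \<exists>y\<in>K. x \<otimes>\<^bsub>SP\<^esub> y \<noteq> y \<otimes>\<^bsub>SP\<^esub> x"
    \<comment> \<open>The condition on centers is transported from \<open>H\<close>: subgroups
      \<open>K\<close> of its copy in the semidirect product correspond to subgroups
      \<open>L\<close> of \<open>H\<close>.\<close>
    define L where "L = {h \<in> carrier H. (\<one>\<^bsub>M\<^esub>, h) \<in> K}"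
    have K_iff: "x \<in> K \<longleftrightarrow> (\<exists>h\<in>L. x = (\<one>\<^bsub>M\<^esub>, h))" for x
      using K(2) by (auto simp: L_def H'_def)
    have mult: "(\<one>\<^bsub>M\<^esub>, h) \<otimes>\<^bsub>SP\<^esub> (\<one>\<^bsub>M\<^esub>, h') = (\<one>\<^bsub>M\<^esub>, h \<otimes>\<^bsub>H\<^esub> h')" if "h \<in> carrier H" for h h'
      using that by (simp add: act_one)
    have L_sub: "subgroup L H"
    proof
      show "L \<subseteq> carrier H" by (auto simp: L_def)
      show "\<one>\<^bsub>H\<^esub> \<in> L" using subgroup.one_closed[OF K(1)] by (simp add: L_def)
      show "h \<otimes>\<^bsub>H\<^esub> h' \<in> L" if "h \<in> L" "h' \<in> L" for h h'
        using that subgroup.m_closed[OF K(1), of "(\<one>\<^bsub>M\<^esub>, h)" "(\<one>\<^bsub>M\<^esub>, h')"] by (simp add: L_def act_one)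
      show "inv\<^bsub>H\<^esub> h \<in> L" if "h \<in> L" for h
        using that subgroup.m_inv_closed[OF K(1), of "(\<one>\<^bsub>M\<^esub>, h)"] group_hom.hom_inv[OF incl, of h]
        by (simp add: L_def)
    qed
    have "\<not> comm_group (H\<lparr>carrier := L\<rparr>)"
    proof
      assume "comm_group (H\<lparr>carrier := L\<rparr>)"
      then have "h \<otimes>\<^bsub>H\<^esub> h' = h' \<otimes>\<^bsub>H\<^esub> h" if "h \<in> L" "h' \<in> L" for h h'
        using comm_monoid.m_comm[of "H\<lparr>carrier := L\<rparr>" h h'] that by (simp add: comm_group_def)
      moreover obtain x y where "x \<in> K" "y \<in> K" "x \<otimes>\<^bsub>SP\<^esub> y \<noteq> y \<otimes>\<^bsub>SP\<^esub> x" using K(3) by blast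
      moreover from this obtain h h' where "h \<in> L" "h' \<in> L" "x = (\<one>\<^bsub>M\<^esub>, h)" "y = (\<one>\<^bsub>M\<^esub>, h')"
        unfolding K_iff by (elim bexE)
      moreover have "h \<in> carrier H" if "h \<in> L" for h using that by (simp add: L_def)
      ultimately show False using mult[of h h'] mult[of h' h] by metis
    qed
    then have el: "elementary_abelian p (H\<lparr>carrier := group_center (H\<lparr>carrier := L\<rparr>)\<rparr>)"
      by (rule assms(3)[OF L_sub])
    show "\<forall>z\<in>K. (\<forall>x\<in>K. z \<otimes>\<^bsub>SP\<^esub> x = x \<otimes>\<^bsub>SP\<^esub> z) \<longrightarrow> z [^]\<^bsub>SP\<^esub> p = \<one>\<^bsub>SP\<^esub>"
    proof (intro ballI impI)
      fix z assume z: "z \<in> K" "\<forall>x\<in>K. z \<otimes>\<^bsub>SP\<^esub> x = x \<otimes>\<^bsub>SP\<^esub> z"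
      obtain h where h: "h \<in> L" "z = (\<one>\<^bsub>M\<^esub>, h)" using z(1) K_iff by blast
      have hc: "h \<in> carrier H" using h(1) by (simp add: L_def)
      have "h \<otimes>\<^bsub>H\<^esub> h' = h' \<otimes>\<^bsub>H\<^esub> h" if h': "h' \<in> L" for h'
      proof -
        have "(\<one>\<^bsub>M\<^esub>, h') \<in> K" "h' \<in> carrier H" using h' by (simp_all add: L_def)
        then show ?thesis using z(2) mult[OF hc, of h'] mult[of h' h] h(2) by auto
      qed
      then have "h \<in> group_center (H\<lparr>carrier := L\<rparr>)" using h(1) by (simp add: group_center_def)
      then have "h [^]\<^bsub>H\<^esub> p = \<one>\<^bsub>H\<^esub>"
        using el H.nat_pow_consistent by (simp add: elementary_abelian_def)
      then show "z [^]\<^bsub>SP\<^esub> p = \<one>\<^bsub>SP\<^esub>"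
        using group_hom.hom_nat_pow[OF incl hc, of p] h(2) by simp
    qed
  next
    fix i assume "i \<in> I"
    then have i: "(i, \<one>\<^bsub>H\<^esub>) \<in> carrier SP" "i \<in> carrier M" using I(1) by auto
    have "conjugate SP (i, \<one>\<^bsub>H\<^esub>) x \<in> H'" if x: "x \<in> H'" for x
    proof -
      have xc: "x \<in> carrier SP" "fst x = \<one>\<^bsub>M\<^esub>" using x H'_iff by blast+
      \<comment> \<open>The copy of \<open>H\<close> is the kernel of \<open>fst\<close> and so is
        preserved by conjugation.\<close>
      have "fst (conjugate SP (i, \<one>\<^bsub>H\<^esub>) x) = i \<otimes>\<^bsub>M\<^esub> \<one>\<^bsub>M\<^esub> \<otimes>\<^bsub>M\<^esub> inv\<^bsub>M\<^esub> i"
        unfolding conjugate_def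
        using group_hom.hom_mult[OF fst_SP SP.m_closed[OF i(1) xc(1)] SP.inv_closed[OF i(1)]]
          group_hom.hom_mult[OF fst_SP i(1) xc(1)] group_hom.hom_inv[OF fst_SP i(1)] xc(2) by simp
      then show ?thesis using SP.conjugate_closed[OF i(1) xc(1)] i(2) unfolding H'_iff by simp
    qed
    then show "normalizes SP H' (i, \<one>\<^bsub>H\<^esub>)" using i(1) by (simp only: normalizes_def) blast
  next
    show "\<one>\<^bsub>SP\<^esub> \<in> carrier SP" by (rule SP.one_closed)
    show "h \<otimes>\<^bsub>SP\<^esub> \<one>\<^bsub>SP\<^esub> = \<one>\<^bsub>SP\<^esub> \<otimes>\<^bsub>SP\<^esub> h" if "h \<in> H'" for h
      using that H'_iff SP.r_one[of h] SP.l_one[of h] by metis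
  qed
  also have "commuting_tuples SP H' I (\<lambda>i. (i, \<one>\<^bsub>H\<^esub>)) I (\<lambda>i. p ^ n i) (\<lambda>_. \<one>\<^bsub>SP\<^esub>)
    = commuting_tuples SP H' I (\<lambda>i. (i, \<one>\<^bsub>H\<^esub>)) I M.ord (\<lambda>_. \<one>\<^bsub>SP\<^esub>)"
    by (rule SP.commuting_tuples_cong) (simp_all add: n)
  also have "card \<dots> = card (crossed_homs M H act)"
    unfolding H'_def
    by (rule card_crossed_homs_eq_commuting_tuples[symmetric, OF I(1,3) ext[unfolded M_upd, THEN bspec, THEN mp, THEN mp]])
      (simp_all add: M.m_comm)
  finally show ?thesis by (simp add: order_M card_H' H(2) gcd.commute)
qed

end
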